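(* Let $K$ be the eyebolted Vicsek cross, and let $R_n(p,q)$, $p,q\in V_0=\{p_1,p_2,p_3,p_4\}$, be the trace on $V_0$ of the network $G_n$ on $V_n$ with unit resistance between any two vertices of each cell $V_\omega$, $|\omega|=n$. Let $a_n=9^n$ for $n\ge 0$, $b_0=1$ and $b_n=9b_{n-1}-\frac{b_{n-1}^2}{9^{n-1}+b_{n-1}}$ for $n\ge1$. Then (i) $R_n(p_i,p_{i+1})=\frac{a_n+b_n}2\asymp a_n$ for $1\le i\le4$ (with $p_5=p_1$); (ii) $R_n(p_1,p_3)=\frac12\Big(a_n+\frac{a_n^2}{b_n}\Big)\asymp\frac{a_n^2}{b_n}$ and $R_n(p_2,p_4)=\frac12\Big(b_n+\frac{b_n^2}{a_n}\Big)\asymp b_n$. Moreover, $\lim_{n\to\infty}b_n/9^n=0$, and for any $0<\varepsilon<9$, $\lim_{n\to\infty}b_n/(9-\varepsilon)^n=\infty$.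
   Context: $f\asymp g$ means $C^{-1}g\le f\le Cg$ for a constant $C>0$ (independent of $n$). **Eyebolted Vicsek cross.** In $\mathbb R^2$ let $p_1=(-\frac12,-\frac12)$, $p_2=(\frac12,-\frac12)$, $p_3=(\frac12,\frac12)$, $p_4=(-\frac12,\frac12)$, and let $S$ be the unit square with these vertices, divided into $81$ sub-squares of side $1/9$; the sub-square with index $(i,j)$, $-4\le i,j\le 4$, has center $(i/9,j/9)$. Select the following $21$ sub-squares: the nine $(k,k)$, $|k|\le 4$ (along $\overline{p_1p_3}$); the eight $(k,-k)$, $1\le |k|\le 4$ (along $\overline{p_2p_4}$); and two "eyebolts", the lower-right one consisting of the pair $(3,-1),(4,-2)$ or the pair $(1,-3),(2,-4)$, and the upper-left one consisting of the pair $(-3,1),(-4,2)$ or the pair $(-1,3),(-2,4)$ (a fixed choice is made for each eyebolt; the assertions do not depend on it). Let $a_1,\dots,a_{21}$ here denote the centers of the selected sub-squares, $F_i(x)=\frac19x+a_i$, and let $K$ be the nonempty compact set with $K=\bigcup_{i=1}^{21}F_i(K)$. Put $V_0=\{p_1,p_2,p_3,p_4\}$, $V_n=\bigcup_{i}F_i(V_{n-1})$; for a word $\omega=\omega_1\cdots\omega_n$, $|\omega|=n$, $F_\omega=F_{\omega_1}\circ\cdots\circ F_{\omega_n}$, $V_\omega=F_\omega(V_0)$. (The sequence $a_n=9^n$ in the claim is unrelated to these centers.) **Trace.** With $E_n[u]=\sum_{|\omega|=n}\sum_{\{x,y\}\subset V_\omega}|u(x)-u(y)|^2$ (unordered pairs)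 for $u:V_n\to\mathbb R$, the trace $R_n(p,q)$ is defined by: for all $u:V_0\to\mathbb R$, $\min\{E_n[v]: v:V_n\to\mathbb R,\ v|_{V_0}=u\}=\sum_{\{p,q\}\subset V_0}\frac1{R_n(p,q)}|u(p)-u(q)|^2$. *)

theory Defs
  imports "HOL-Analysis.Analysis"
begin

type_synonym point = "real \<times> real"
type_synonym index = "int \<times> int"

text \<open>The corners are indexed cyclically, so that \<open>corner 5 = corner 1\<close>
  (and the list below starts with the corner of index 4).\<close>

definition corner :: "nat \<Rightarrow> point" where
  "corner i = [(-1/2, 1/2), (-1/2, -1/2), (1/2, -1/2), (1/2, 1/2)] ! (i mod 4)"

definition V0 :: "point set" where
  "V0 = corner ` {1..4}"

text \<open>A sub-square is named by its index \<open>(i, j)\<close>; its center is \<open>(i/9, j/9)\<close>.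
  The index set of the 21 selected sub-squares depends on a choice made for the lower-right
  and for the upper-left eyebolt.\<close>

definition eyebolted :: "index set \<Rightarrow> bool" where
  "eyebolted I \<longleftrightarrow>
    (\<exists>lr \<in> {{(3, -1), (4, -2)}, {(1, -3), (2, -4)}}.
     \<exists>ul \<in> {{(-3, 1), (-4, 2)}, {(-1, 3), (-2, 4)}}.
       I = {(k, k) | k. \<bar>k\<bar> \<le> 4} \<union> {(k, -k) | k. 1 \<le> \<bar>k\<bar> \<and> \<bar>k\<bar> \<le> 4} \<union> lr \<union> ul)"

definition F :: "index \<Rightarrow> point \<Rightarrow> point" where
  "F i x = (1/9) *\<^sub>R x + (of_int (fst i) / 9, of_int (snd i) / 9)"

definition eyebolted_vicsek_cross :: "index set \<Rightarrow> point set \<Rightarrow> bool" where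
  "eyebolted_vicsek_cross I K \<longleftrightarrow>
    eyebolted I \<and> compact K \<and> K \<noteq> {} \<and> K = (\<Union>i\<in>I. F i ` K)"

primrec V :: "index set \<Rightarrow> nat \<Rightarrow> point set" where
  "V I 0 = V0"
| "V I (Suc n) = (\<Union>i\<in>I. F i ` V I n)"

definition words :: "index set \<Rightarrow> nat \<Rightarrow> index list set" where
  "words I n = {w. set w \<subseteq> I \<and> length w = n}"

text \<open>\<open>F_word [i\<^sub>1, \<dots>, i\<^sub>n] = F i\<^sub>1 \<circ> \<dots> \<circ> F i\<^sub>n\<close>.\<close>

definition F_word :: "index list \<Rightarrow> point \<Rightarrow> point" where
  "F_word w = foldr F w"

definition V_word :: "index list \<Rightarrow> point set" where
  "V_word w = F_word w ` V0"

text \<open>The energy on \<open>A\<close> with conductances \<open>c\<close>, which will always be symmetric.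
  The sum over unordered pairs is written as half the sum over ordered pairs;
  the diagonal terms vanish.\<close>

definition pair_energy :: "point set \<Rightarrow> (point \<Rightarrow> point \<Rightarrow> real) \<Rightarrow> (point \<Rightarrow> real) \<Rightarrow> real" where
  "pair_energy A c u = (\<Sum>x\<in>A. \<Sum>y\<in>A. c x y * \<bar>u x - u y\<bar>\<^sup>2) / 2"

definition energy :: "index set \<Rightarrow> nat \<Rightarrow> (point \<Rightarrow> real) \<Rightarrow> real" where
  "energy I n u = (\<Sum>w\<in>words I n. pair_energy (V_word w) (\<lambda>_ _. 1) u)"

definition is_minimum :: "real \<Rightarrow> real set \<Rightarrow> bool" where
  "is_minimum m S \<longleftrightarrow> m \<in> S \<and> (\<forall>s\<in>S. m \<le> s)"

text \<open>Functions on \<open>V I n\<close> are represented by extensional functions.\<close>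

definition is_trace :: "index set \<Rightarrow> nat \<Rightarrow> (point \<Rightarrow> point \<Rightarrow> real) \<Rightarrow> bool" where
  "is_trace I n R \<longleftrightarrow>
    (\<forall>p\<in>V0. \<forall>q\<in>V0. R p q = R q p) \<and>
    (\<forall>u. is_minimum (pair_energy V0 (\<lambda>p q. 1 / R p q) u)
           {energy I n v | v. v \<in> V I n \<rightarrow>\<^sub>E UNIV \<and> (\<forall>p\<in>V0. v p = u p)})"

text \<open>Since the quadratic form determines its coefficients, the values of the trace at pairs of
  distinct points of \<open>V0\<close> do not depend on the choice; only these are meaningful.\<close>

definition trace_resistance :: "index set \<Rightarrow> nat \<Rightarrow> point \<Rightarrow> point \<Rightarrow> real" where
  "trace_resistance I n = (SOME R. is_trace I n R)"

definition comparable :: "(nat \<Rightarrow> real) \<Rightarrow> (nat \<Rightarrow> real) \<Rightarrow> bool" (infix "\<asymp>" 50) where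
  "f \<asymp> g \<longleftrightarrow> (\<exists>C>0. \<forall>n. inverse C * g n \<le> f n \<and> f n \<le> C * g n)"

text \<open>For every choice of the eyebolts the cross exists.\<close>

lemma eyebolted_nonempty: "eyebolted I \<Longrightarrow> I \<noteq> {}"
  unfolding eyebolted_def by auto

lemma eyebolted_bounds: "eyebolted I \<Longrightarrow> i \<in> I \<Longrightarrow> \<bar>fst i\<bar> \<le> 4 \<and> \<bar>snd i\<bar> \<le> 4"
  unfolding eyebolted_def by auto

lemma eyebolted_finite:
  assumes "eyebolted I" shows "finite I"
proof (rule finite_subset)
  show "I \<subseteq> {-4..4} \<times> {-4..4}"
    using eyebolted_bounds[OF assms] by (fastforce simp: abs_le_iff)
qed simp

lemma eyebolted_vicsek_cross_exists:
  assumes I: "eyebolted I"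
  shows "\<exists>K. eyebolted_vicsek_cross I K"
proof -
  define T where "T A = (\<Union>i\<in>I. F i ` A)" for A
  define S where "S = {-1/2..1/2::real} \<times> {-1/2..1/2::real}"
  define A where "A n = (T ^^ n) S" for n
  define K where "K = (\<Inter>n. A n)"
  have A0: "A 0 = S" and AS: "A (Suc n) = T (A n)" for n
    by (simp_all add: A_def)
  have Tmono: "B \<subseteq> C \<Longrightarrow> T B \<subseteq> T C" for B C
    unfolding T_def by blast
  have FS: "F i x \<in> S" if "i \<in> I" "x \<in> S" for i x
  proof -
    have b: "\<bar>real_of_int (fst i)\<bar> \<le> 4" "\<bar>real_of_int (snd i)\<bar> \<le> 4"
      using eyebolted_bounds[OF I that(1)] by linarith+
    show ?thesis using that(2) b
      by (cases x) (auto simp: S_def F_def field_simps abs_le_iff)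
  qed
  have dec1: "A (Suc n) \<subseteq> A n" for n
  proof (induction n)
    case 0 show ?case using FS by (auto simp: A0 AS T_def)
  next
    case (Suc n) thus ?case using Tmono by (simp add: AS)
  qed
  have dec: "A n \<subseteq> A m" if "m \<le> n" for m n
    using that dec1 by (rule lift_Suc_antimono_le[of A, rotated])
  have cont: "continuous_on B (F i)" for B i
    unfolding F_def by (intro continuous_intros)
  have comp: "compact (A n)" for n
  proof (induction n)
    case 0 show ?case by (simp add: A0 S_def compact_Times)
  next
    case (Suc n) thus ?case unfolding AS T_def
      using eyebolted_finite[OF I] by (intro compact_UN compact_continuous_image cont) auto
  qed
  have ne: "A n \<noteq> {}" for n
  proof (induction n)
    case 0 show ?case by (simp add: A0 S_def)
  next
    case (Suc n) thus ?case using eyebolted_nonempty[OF I] by (auto simp: AS T_def)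
  qed
  have "compact K"
    unfolding K_def by (intro compact_Inter) (use comp in auto)
  moreover have "K \<noteq> {}"
    unfolding K_def by (rule compact_nest[OF comp ne dec])
  moreover have "K \<subseteq> T K"
  proof
    fix x assume x: "x \<in> K"
    have "\<exists>i\<in>I. x \<in> F i ` A n" for n
    proof -
      have "x \<in> A (Suc n)" using x unfolding K_def by blast
      thus ?thesis by (simp add: AS T_def)
    qed
    then obtain j where j: "\<And>n. j n \<in> I" "\<And>n. x \<in> F (j n) ` A n"
      by metis
    have "finite (range j)"
      using j(1) eyebolted_finite[OF I] by (meson finite_subset image_subsetI)
    then obtain m where inf: "infinite {n. j n = j m}"
      using pigeonhole_infinite[of UNIV j] by auto
    have xm: "x \<in> F (j m) ` A n" for n
    proof -
      obtain k where "k \<ge> n" "j k = j m"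
        using inf by (metis (mono_tags, lifting) infinite_nat_iff_unbounded_le mem_Collect_eq)
      thus ?thesis using j(2)[of k] dec by auto
    qed
    have inj: "inj (F (j m))"
      by (rule injI) (simp add: F_def)
    obtain y where y: "x = F (j m) y" using xm[of 0] by auto
    have "y \<in> K"
      using xm inj unfolding K_def y by (simp add: inj_image_mem_iff)
    thus "x \<in> T K" using j(1) y unfolding T_def by blast
  qed
  moreover have "T K \<subseteq> K"
  proof -
    have "T K \<subseteq> A n" for n
      using dec1[of n] Tmono[of K "A n"] by (auto simp: K_def AS)
    thus ?thesis unfolding K_def by blast
  qed
  ultimately show ?thesis
    using I unfolding eyebolted_vicsek_cross_def T_def by blast
qed

end

theory Submission imports Defs begin

text \<open>The trace of every level on the four corners is a star: a hub joined to \<open>sw\<close> and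
  \<open>ne\<close> by resistances \<open>a/4\<close> and to \<open>se\<close> and \<open>nw\<close> by resistances \<open>b/4\<close>. The complete graph of
  level 0 is the case \<open>a = b = 1\<close>. The energy of a star, minimized over the potential of the
  hub, is the quadratic form \<open>cell_form a b\<close>, and its mutual conductances are the inverses of the
  resistances \<open>(a + b)/2\<close>, \<open>(a + a\<^sup>2/b)/2\<close> and \<open>(b + b\<^sup>2/a)/2\<close>.

  Suppose that the cells of level \<open>n\<close> are such stars. Two neighbouring cells share exactly one
  corner, a corner that lies between two equal arms, so eliminating the shared corners leaves a
  network on the 21 hubs in which diagonal neighbours are joined by \<open>a/2\<close> or \<open>b/2\<close>
  (\<open>hub_energy\<close>). Seen from the central hub it consists of four arms. The arms towards \<open>sw\<close> and
  \<open>ne\<close> are series connections of total resistance \<open>9a/4\<close>. In the arms towards \<open>se\<close> and \<open>nw\<close> the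
  eyebolt puts a detour of resistance \<open>a + b/2\<close> parallel to one link \<open>b/2\<close>, which lowers
  \<open>9b/4\<close> by \<open>b\<^sup>2/(4(a + b))\<close>. The result is again a star, with \<open>9a\<close> and \<open>next_b a b\<close> in place of
  \<open>a\<close> and \<open>b\<close>, which is the recursion of the theorem.

  Both inequalities of the induction step go through the hub network. For the lower bound
  (\<open>trace_step_ge\<close>) every cell gets the optimal hub of the given function; for the upper bound
  (\<open>trace_step_le\<close>) optimal hub potentials determine boundary values for every cell, and the
  minimizers of the cells fit together (\<open>glue_cells\<close>) because distinct cells meet only in
  corners (\<open>cells_touch\<close>). The quadratic form determines its conductances, which gives the
  formulas for the resistances.

  For the asymptotics, the ratio \<open>t = b/a\<close> follows \<open>t \<mapsto> t - t\<^sup>2/(9(1 + t))\<close>, a decreasing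
  recursion whose only fixed point is 0. Hence the growth factor of \<open>b\<close>, which is
  \<open>9 - t/(1 + t)\<close>, tends to 9 from below.\<close>

section \<open>Corners and stars\<close>

definition sw :: point where "sw = (-1/2, -1/2)"
definition se :: point where "se = (1/2, -1/2)"
definition ne :: point where "ne = (1/2, 1/2)"
definition nw :: point where "nw = (-1/2, 1/2)"

lemmas corner_defs = sw_def se_def ne_def nw_def

lemma corners_distinct [simp]:
  "sw \<noteq> se" "sw \<noteq> ne" "sw \<noteq> nw" "se \<noteq> sw" "se \<noteq> ne" "se \<noteq> nw"
  "ne \<noteq> sw" "ne \<noteq> se" "ne \<noteq> nw" "nw \<noteq> sw" "nw \<noteq> se" "nw \<noteq> ne"
  by (simp_all add: corner_defs)

lemma corner_eqs:
  "corner 1 = sw" "corner 2 = se" "corner 3 = ne" "corner 4 = nw" "corner 5 = sw"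
  by (simp_all add: corner_def corner_defs)

lemma V0_eq: "V0 = {sw, se, ne, nw}"
proof -
  have "{1..4::nat} = {1, 2, 3, 4}" by auto
  then show ?thesis by (simp only: V0_def image_insert image_empty corner_eqs)
qed

text \<open>The energy of a star whose hub has potential \<open>c\<close>.\<close>

definition star_energy :: "real \<Rightarrow> real \<Rightarrow> (point \<Rightarrow> real) \<Rightarrow> real \<Rightarrow> real" where
  "star_energy a b u c =
     ((u sw - c)\<^sup>2 + (u ne - c)\<^sup>2) / (a / 4) + ((u se - c)\<^sup>2 + (u nw - c)\<^sup>2) / (b / 4)"

text \<open>The energy of the star after its hub has been eliminated, written in the coordinates that
  diagonalize it: the two diagonal differences, and the difference of the sums over the two
  diagonals.\<close>

definition cell_form :: "real \<Rightarrow> real \<Rightarrow> (point \<Rightarrow> real) \<Rightarrow> real" where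
  "cell_form a b u =
     2 * (u sw - u ne)\<^sup>2 / a + 2 * (u se - u nw)\<^sup>2 / b
     + 2 * (u sw + u ne - u se - u nw)\<^sup>2 / (a + b)"

text \<open>As a quadratic polynomial in \<open>c\<close>, the energy is minimal at the average of the corner
  potentials weighted by their conductances; this completes the square there.\<close>

lemma star_energy_decomposition:
  assumes "a > 0" "b > 0"
  shows "star_energy a b u c = cell_form a b u
    + 8 * (a + b) / (a * b) * (c - (b * (u sw + u ne) + a * (u se + u nw)) / (2 * (a + b)))\<^sup>2"
proof -
  have "a + b \<noteq> 0" using assms by linarith
  then show ?thesis using assms
    by (simp add: star_energy_def cell_form_def divide_simps) (simp add: power2_eq_square algebra_simps)
qed

lemma cell_form_le_star_energy:
  assumes "a > 0" "b > 0" shows "cell_form a b u \<le> star_energy a b u c"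
  unfolding star_energy_decomposition[OF assms] using assms by simp

lemma cell_form_eq_star_energy:
  assumes "a > 0" "b > 0" obtains c where "star_energy a b u c = cell_form a b u"
  using star_energy_decomposition[OF assms,
      of u "(b * (u sw + u ne) + a * (u se + u nw)) / (2 * (a + b))"]
  by auto

lemma cell_form_cong:
  assumes "\<And>p. p \<in> V0 \<Longrightarrow> u p = v p" shows "cell_form a b u = cell_form a b v"
  unfolding cell_form_def using assms by (simp add: V0_eq)

section \<open>Series and parallel connections\<close>

text \<open>Eliminating the midpoint of two resistors in series. The defect is the square of the current
  imbalance at \<open>y\<close>, up to a positive factor.\<close>

lemma series_le:
  fixes x y z r s :: real
  assumes "r > 0" "s > 0"
  shows "(x - z)\<^sup>2 / (r + s) \<le> (x - y)\<^sup>2 / r + (y - z)\<^sup>2 / s"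
proof -
  have "r + s \<noteq> 0" using assms by linarith
  then have "(x - y)\<^sup>2 / r + (y - z)\<^sup>2 / s - (x - z)\<^sup>2 / (r + s)
      = (s * (x - y) - r * (y - z))\<^sup>2 / (r * s * (r + s))"
    using assms by (simp add: divide_simps) (simp add: power2_eq_square algebra_simps)
  moreover have "\<dots> \<ge> 0" using assms by simp
  ultimately show ?thesis by linarith
qed

text \<open>The linear interpolation makes the two currents equal.\<close>

lemma series_eq:
  fixes x z r s :: real
  assumes "r > 0" "s > 0"
  obtains y where "(x - y)\<^sup>2 / r + (y - z)\<^sup>2 / s = (x - z)\<^sup>2 / (r + s)"
proof
  have n: "r + s \<noteq> 0" using assms by linarith
  let ?y = "x + (z - x) * (r / (r + s))"
  have "x - ?y = r * ((x - z) / (r + s))" "?y - z = s * ((x - z) / (r + s))"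
    using n by (simp_all add: divide_simps) (simp_all add: algebra_simps)
  then show "(x - ?y)\<^sup>2 / r + (?y - z)\<^sup>2 / s = (x - z)\<^sup>2 / (r + s)"
    using assms n by (simp only: power_mult_distrib)
      (simp add: divide_simps, simp add: power2_eq_square algebra_simps)
qed

text \<open>The arm from the central hub \<open>h0\<close> to the corner of potential \<open>u\<close>: two half-arms \<open>a/4\<close> make a
  link \<open>a/2\<close> between consecutive hubs, and a single half-arm reaches the corner.\<close>

definition plain_arm :: "real \<Rightarrow> real \<Rightarrow> real \<Rightarrow> real \<Rightarrow> real \<Rightarrow> real \<Rightarrow> real \<Rightarrow> real" where
  "plain_arm a h0 h1 h2 h3 h4 u =
     (h0 - h1)\<^sup>2 / (a/2) + ((h1 - h2)\<^sup>2 / (a/2) + ((h2 - h3)\<^sup>2 / (a/2)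
     + ((h3 - h4)\<^sup>2 / (a/2) + (h4 - u)\<^sup>2 / (a/4))))"

lemma plain_arm_ge:
  assumes "a > 0"
  shows "(h0 - u)\<^sup>2 / (9 * a / 4) \<le> plain_arm a h0 h1 h2 h3 h4 u"
proof -
  have R: "9 * a / 4 = a/2 + (a/2 + (a/2 + (a/2 + a/4)))" by simp
  have p: "a/2 > 0" "a/4 > 0" "a/2 + a/4 > 0" "a/2 + (a/2 + a/4) > 0"
      "a/2 + (a/2 + (a/2 + a/4)) > 0"
    using assms by auto
  show ?thesis unfolding plain_arm_def R
    using series_le[OF p(1,5), of h0 u h1] series_le[OF p(1,4), of h1 u h2]
      series_le[OF p(1,3), of h2 u h3] series_le[OF p(1,2), of h3 u h4]
    by linarith
qed

lemma plain_arm_eq: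
  assumes "a > 0"
  obtains h1 h2 h3 h4 where "plain_arm a h0 h1 h2 h3 h4 u = (h0 - u)\<^sup>2 / (9 * a / 4)"
proof -
  have R: "9 * a / 4 = a/2 + (a/2 + (a/2 + (a/2 + a/4)))" by simp
  have p: "a/2 > 0" "a/4 > 0" "a/2 + a/4 > 0" "a/2 + (a/2 + a/4) > 0"
      "a/2 + (a/2 + (a/2 + a/4)) > 0"
    using assms by auto
  obtain h1 where 1: "(h0 - h1)\<^sup>2 / (a/2) + (h1 - u)\<^sup>2 / (a/2 + (a/2 + (a/2 + a/4)))
      = (h0 - u)\<^sup>2 / (9 * a / 4)"
    unfolding R using series_eq[OF p(1,5)] by blast
  obtain h2 where 2: "(h1 - h2)\<^sup>2 / (a/2) + (h2 - u)\<^sup>2 / (a/2 + (a/2 + a/4))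
      = (h1 - u)\<^sup>2 / (a/2 + (a/2 + (a/2 + a/4)))"
    using series_eq[OF p(1,4)] by blast
  obtain h3 where 3: "(h2 - h3)\<^sup>2 / (a/2) + (h3 - u)\<^sup>2 / (a/2 + a/4)
      = (h2 - u)\<^sup>2 / (a/2 + (a/2 + a/4))"
    using series_eq[OF p(1,3)] by blast
  obtain h4 where 4: "(h3 - h4)\<^sup>2 / (a/2) + (h4 - u)\<^sup>2 / (a/4) = (h3 - u)\<^sup>2 / (a/2 + a/4)"
    using series_eq[OF p(1,2)] by blast
  show ?thesis
    by (rule that[of h1 h2 h3 h4]) (simp only: plain_arm_def 1 2 3 4)
qed

text \<open>The recursion for \<open>b\<close>, with \<open>a = 9 ^ n\<close> on level \<open>n\<close>.\<close>

definition next_b :: "real \<Rightarrow> real \<Rightarrow> real" where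
  "next_b a b = 9 * b - b\<^sup>2 / (a + b)"

text \<open>A link \<open>b/2\<close> parallel to the detour of three links \<open>a/2\<close>, \<open>b/2\<close>, \<open>a/2\<close>.\<close>

definition loop_resistance :: "real \<Rightarrow> real \<Rightarrow> real" where
  "loop_resistance a b = (b/2) * (a + b/2) / (a + b)"

text \<open>An arm along the other diagonal; \<open>d\<close> and \<open>e\<close> are the hubs of the two eyebolt cells,
  attached to \<open>h2\<close> and \<open>h3\<close> across corners of type \<open>a\<close>. The parentheses follow the order in
  which the chain is reduced.\<close>

definition eyebolt_arm ::
  "real \<Rightarrow> real \<Rightarrow> real \<Rightarrow> real \<Rightarrow> real \<Rightarrow> real \<Rightarrow> real \<Rightarrow> real \<Rightarrow> real \<Rightarrow> real \<Rightarrow> real" where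
  "eyebolt_arm a b h0 h1 h2 h3 h4 d e u =
     (h0 - h1)\<^sup>2 / (b/2) + ((h1 - h2)\<^sup>2 / (b/2)
     + (((h2 - h3)\<^sup>2 / (b/2) + ((h2 - d)\<^sup>2 / (a/2) + ((d - e)\<^sup>2 / (b/2) + (e - h3)\<^sup>2 / (a/2))))
     + ((h3 - h4)\<^sup>2 / (b/2) + (h4 - u)\<^sup>2 / (b/4))))"

lemma loop_resistance_pos: "a > 0 \<Longrightarrow> b > 0 \<Longrightarrow> loop_resistance a b > 0"
  by (simp add: loop_resistance_def)

lemma parallel_loop:
  assumes "a > 0" "b > 0"
  shows "t / (b/2) + t / (a/2 + (b/2 + a/2)) = t / loop_resistance a b"
proof -
  have "a + b \<noteq> 0" "a + b/2 \<noteq> 0" "2 * a + b \<noteq> 0" using assms by linarith+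
  then show ?thesis using assms
    by (simp add: loop_resistance_def divide_simps) (simp add: algebra_simps)
qed

text \<open>The place where the recursion for \<open>b\<close> comes from: the hubs 0 to 4 and the corner are connected by
  the links \<open>b/2\<close>, \<open>b/2\<close>, the loop, \<open>b/2\<close> and \<open>b/4\<close>.\<close>

lemma next_b_series:
  assumes "a > 0" "b > 0"
  shows "next_b a b / 4 = b/2 + (b/2 + (loop_resistance a b + (b/2 + b/4)))"
proof -
  have "a + b \<noteq> 0" using assms by linarith
  then show ?thesis
    by (simp add: next_b_def loop_resistance_def divide_simps)
       (simp add: power2_eq_square algebra_simps)
qed

lemma eyebolt_arm_ge:
  assumes "a > 0" "b > 0"
  shows "(h0 - u)\<^sup>2 / (next_b a b / 4) \<le> eyebolt_arm a b h0 h1 h2 h3 h4 d e u"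
proof -
  let ?r = "loop_resistance a b"
  note r = loop_resistance_pos[OF assms]
  have p: "a/2 > 0" "b/2 > 0" "b/4 > 0" "b/2 + a/2 > 0" "b/2 + b/4 > 0"
      "?r + (b/2 + b/4) > 0" "b/2 + (?r + (b/2 + b/4)) > 0"
    using assms r by auto
  show ?thesis unfolding eyebolt_arm_def next_b_series[OF assms]
    using series_le[OF p(2,7), of h0 u h1] series_le[OF p(2,6), of h1 u h2]
      series_le[OF r p(5), of h2 u h3] series_le[OF p(2,3), of h3 u h4]
      series_le[OF p(1,4), of h2 h3 d] series_le[OF p(2,1), of d h3 e]
      parallel_loop[OF assms, of "(h2 - h3)\<^sup>2"]
    by linarith
qed

lemma eyebolt_arm_eq:
  assumes "a > 0" "b > 0"
  obtains h1 h2 h3 h4 d e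
  where "eyebolt_arm a b h0 h1 h2 h3 h4 d e u = (h0 - u)\<^sup>2 / (next_b a b / 4)"
proof -
  let ?r = "loop_resistance a b"
  note r = loop_resistance_pos[OF assms]
  have p: "a/2 > 0" "b/2 > 0" "b/4 > 0" "b/2 + a/2 > 0" "b/2 + b/4 > 0"
      "?r + (b/2 + b/4) > 0" "b/2 + (?r + (b/2 + b/4)) > 0"
    using assms r by auto
  obtain h1 where 1: "(h0 - h1)\<^sup>2 / (b/2) + (h1 - u)\<^sup>2 / (b/2 + (?r + (b/2 + b/4)))
      = (h0 - u)\<^sup>2 / (next_b a b / 4)"
    unfolding next_b_series[OF assms] using series_eq[OF p(2,7)] by blast
  obtain h2 where 2: "(h1 - h2)\<^sup>2 / (b/2) + (h2 - u)\<^sup>2 / (?r + (b/2 + b/4))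
      = (h1 - u)\<^sup>2 / (b/2 + (?r + (b/2 + b/4)))"
    using series_eq[OF p(2,6)] by blast
  obtain h3 where 3: "(h2 - h3)\<^sup>2 / ?r + (h3 - u)\<^sup>2 / (b/2 + b/4)
      = (h2 - u)\<^sup>2 / (?r + (b/2 + b/4))"
    using series_eq[OF r p(5)] by blast
  obtain h4 where 4: "(h3 - h4)\<^sup>2 / (b/2) + (h4 - u)\<^sup>2 / (b/4) = (h3 - u)\<^sup>2 / (b/2 + b/4)"
    using series_eq[OF p(2,3)] by blast
  obtain d where 5: "(h2 - d)\<^sup>2 / (a/2) + (d - h3)\<^sup>2 / (b/2 + a/2)
      = (h2 - h3)\<^sup>2 / (a/2 + (b/2 + a/2))"
    using series_eq[OF p(1,4)] by blast
  obtain e where 6: "(d - e)\<^sup>2 / (b/2) + (e - h3)\<^sup>2 / (a/2) = (d - h3)\<^sup>2 / (b/2 + a/2)"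
    using series_eq[OF p(2,1)] by blast
  show ?thesis
    by (rule that[of h1 h2 h3 h4 d e])
      (simp only: eyebolt_arm_def 1 2 3 4 5 6 parallel_loop[OF assms])
qed

section \<open>The network of hubs\<close>

text \<open>Each link between neighbouring cells is listed once, by its south-western or south-eastern end.
  The last two lines attach the four outermost hubs to the corners of the large square.\<close>

definition hub_energy ::
  "index set \<Rightarrow> real \<Rightarrow> real \<Rightarrow> (index \<Rightarrow> real) \<Rightarrow> (point \<Rightarrow> real) \<Rightarrow> real" where
  "hub_energy I a b h u =
     (\<Sum>i | i \<in> I \<and> i + (1, 1) \<in> I. (h i - h (i + (1, 1)))\<^sup>2) / (a/2)
     + (\<Sum>i | i \<in> I \<and> i + (-1, 1) \<in> I. (h i - h (i + (-1, 1)))\<^sup>2) / (b/2)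
     + ((h (-4, -4) - u sw)\<^sup>2 + (h (4, 4) - u ne)\<^sup>2) / (a/4)
     + ((h (4, -4) - u se)\<^sup>2 + (h (-4, 4) - u nw)\<^sup>2) / (b/4)"

text \<open>\<open>D\<close> and \<open>E\<close> are the inner and the outer cell of the lower-right eyebolt, \<open>D'\<close> and \<open>E'\<close> those of
  the upper-left one. An explicit list of the cells makes the links computable.\<close>

lemma eyebolted_explicit:
  assumes "eyebolted I"
  obtains D E D' E' where
    "(D, E) \<in> {((3, -1), (4, -2)), ((1, -3), (2, -4))}"
    "(D', E') \<in> {((-3, 1), (-4, 2)), ((-1, 3), (-2, 4))}"
    "I = {(-4, -4), (-3, -3), (-2, -2), (-1, -1), (0, 0), (1, 1), (2, 2), (3, 3), (4, 4),
      (-4, 4), (-3, 3), (-2, 2), (-1, 1), (1, -1), (2, -2), (3, -3), (4, -4), D, E, D', E'}"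
proof -
  have "{k::int. \<bar>k\<bar> \<le> 4} = {-4..4}" by auto
  also have "\<dots> = {-4, -3, -2, -1, 0, 1, 2, 3, 4}"
    by (simp add: upto.simps set_upto[symmetric] del: set_upto)
  finally have 1: "{(k, k) | k::int. \<bar>k\<bar> \<le> 4}
      = (\<lambda>k. (k, k)) ` {-4, -3, -2, -1, 0, 1, 2, 3, 4}"
    by blast
  have "{k::int. 1 \<le> \<bar>k\<bar> \<and> \<bar>k\<bar> \<le> 4} = {1..4} \<union> {-4..-1}" by auto
  also have "\<dots> = {-4, -3, -2, -1, 1, 2, 3, 4}"
    by (simp add: upto.simps set_upto[symmetric] del: set_upto)
  finally have 2: "{(k, -k) | k::int. 1 \<le> \<bar>k\<bar> \<and> \<bar>k\<bar> \<le> 4}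
      = (\<lambda>k. (k, -k)) ` {-4, -3, -2, -1, 1, 2, 3, 4}"
    by blast
  obtain lr ul where lr: "lr \<in> {{(3, -1), (4, -2)}, {(1, -3), (2, -4)}}"
    and ul: "ul \<in> {{(-3, 1), (-4, 2)}, {(-1, 3), (-2, 4)}}"
    and I: "I = {(k, k) | k. \<bar>k\<bar> \<le> 4} \<union> {(k, -k) | k. 1 \<le> \<bar>k\<bar> \<and> \<bar>k\<bar> \<le> 4} \<union> lr \<union> ul"
    using assms unfolding eyebolted_def by (elim bexE)
  obtain D E where DE: "(D, E) \<in> {((3, -1), (4, -2)), ((1, -3), (2, -4))}" "lr = {D, E}"
    using lr by blast
  obtain D' E' where DE': "(D', E') \<in> {((-3, 1), (-4, 2)), ((-1, 3), (-2, 4))}" "ul = {D', E'}"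
    using ul by blast
  show ?thesis
    by (rule that[OF DE(1) DE'(1)]) (simp only: I DE(2) DE'(2) 1 2 image_insert image_empty
      Un_insert_left Un_empty_left minus_minus)
qed

definition arms_energy :: "index \<Rightarrow> index \<Rightarrow> index \<Rightarrow> index \<Rightarrow> real \<Rightarrow> real
    \<Rightarrow> (index \<Rightarrow> real) \<Rightarrow> (point \<Rightarrow> real) \<Rightarrow> real" where
  "arms_energy D E D' E' a b h u =
       plain_arm a (h (0, 0)) (h (-1, -1)) (h (-2, -2)) (h (-3, -3)) (h (-4, -4)) (u sw)
       + plain_arm a (h (0, 0)) (h (1, 1)) (h (2, 2)) (h (3, 3)) (h (4, 4)) (u ne)
       + eyebolt_arm a b (h (0, 0)) (h (1, -1)) (h (2, -2)) (h (3, -3)) (h (4, -4))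
           (h D) (h E) (u se)
       + eyebolt_arm a b (h (0, 0)) (h (-1, 1)) (h (-2, 2)) (h (-3, 3)) (h (-4, 4))
           (h D') (h E') (u nw)"

text \<open>The links, sorted by the arm to which they belong. The symmetry of \<open>q\<close> is what makes the result
  the same for both choices of an eyebolt: the link between \<open>(2, -2)\<close> and \<open>D\<close>, for example, has its
  lower end at \<open>(2, -2)\<close> for one choice and at \<open>D\<close> for the other.\<close>

lemma edge_sums:
  fixes q :: "index \<Rightarrow> index \<Rightarrow> real"
  assumes DE: "D = (3, -1) \<and> E = (4, -2) \<or> D = (1, -3) \<and> E = (2, -4)"
    and DE': "D' = (-3, 1) \<and> E' = (-4, 2) \<or> D' = (-1, 3) \<and> E' = (-2, 4)"
    and I: "I = {(-4, -4), (-3, -3), (-2, -2), (-1, -1), (0, 0), (1, 1), (2, 2), (3, 3), (4, 4),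
      (-4, 4), (-3, 3), (-2, 2), (-1, 1), (1, -1), (2, -2), (3, -3), (4, -4), D, E, D', E'}"
    and q: "\<And>i j. q i j = q j i"
  shows "(\<Sum>i | i \<in> I \<and> i + (1, 1) \<in> I. q i (i + (1, 1))) =
      q (0, 0) (-1, -1) + q (-1, -1) (-2, -2) + q (-2, -2) (-3, -3) + q (-3, -3) (-4, -4)
      + q (0, 0) (1, 1) + q (1, 1) (2, 2) + q (2, 2) (3, 3) + q (3, 3) (4, 4)
      + q (2, -2) D + q E (3, -3) + q (-2, 2) D' + q E' (-3, 3)" (is ?diag)
    and "(\<Sum>i | i \<in> I \<and> i + (-1, 1) \<in> I. q i (i + (-1, 1))) =
      q (0, 0) (1, -1) + q (1, -1) (2, -2) + q (2, -2) (3, -3) + q (3, -3) (4, -4)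
      + q (0, 0) (-1, 1) + q (-1, 1) (-2, 2) + q (-2, 2) (-3, 3) + q (-3, 3) (-4, 4)
      + q D E + q D' E'" (is ?anti)
proof -
  have fin: "finite I" unfolding I by simp
  show ?diag
    unfolding sum.inter_filter[OF fin] using DE DE' unfolding I
    by (elim disjE conjE; simp add: zero_prod_def; simp add: q)
  show ?anti
    unfolding sum.inter_filter[OF fin] using DE DE' unfolding I
    by (elim disjE conjE; simp add: zero_prod_def; simp add: q)
qed

text \<open>Besides the decomposition, this records what distinguishes the eyebolt cells from each other
  and from the cells on the two diagonals, so that potentials can be prescribed on all hubs
  independently of the choice of the eyebolts.\<close>

lemma hub_energy_arms:
  assumes "eyebolted I"
  obtains D E D' E' where
    "fst D - snd D = 4" "fst E - snd E = 6" "fst D' - snd D' = -4" "fst E' - snd E' = -6"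
    "\<And>i. i \<in> {D, E, D', E'} \<Longrightarrow> fst i + snd i \<noteq> 0"
    "\<And>a b h u. hub_energy I a b h u = arms_energy D E D' E' a b h u"
proof -
  obtain D E D' E' where DE: "(D, E) \<in> {((3, -1), (4, -2)), ((1, -3), (2, -4))}"
    "(D', E') \<in> {((-3, 1), (-4, 2)), ((-1, 3), (-2, 4))}"
    and I: "I = {(-4, -4), (-3, -3), (-2, -2), (-1, -1), (0, 0), (1, 1), (2, 2), (3, 3), (4, 4),
      (-4, 4), (-3, 3), (-2, 2), (-1, 1), (1, -1), (2, -2), (3, -3), (4, -4), D, E, D', E'}"
    using eyebolted_explicit[OF assms] .
  have DE': "D = (3, -1) \<and> E = (4, -2) \<or> D = (1, -3) \<and> E = (2, -4)"
    "D' = (-3, 1) \<and> E' = (-4, 2) \<or> D' = (-1, 3) \<and> E' = (-2, 4)"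
    using DE by simp_all
  show ?thesis
  proof (rule that[of D E D' E'])
    show "fst D - snd D = 4" "fst E - snd E = 6" "fst D' - snd D' = -4" "fst E' - snd E' = -6"
      using DE' by auto
    show "fst i + snd i \<noteq> 0" if "i \<in> {D, E, D', E'}" for i
      using DE' that by auto
    fix a b :: real and h :: "index \<Rightarrow> real" and u :: "point \<Rightarrow> real"
    note edges = edge_sums[OF DE' I, of "\<lambda>i j. (h i - h j)\<^sup>2", OF power2_commute]
    show "hub_energy I a b h u = arms_energy D E D' E' a b h u"
      unfolding hub_energy_def arms_energy_def edges plain_arm_def eyebolt_arm_def
        add_divide_distrib
      by linarith
  qed
qed

lemma star_energy_arms:
  "star_energy a b u c = (c - u sw)\<^sup>2 / (a / 4) + (c - u ne)\<^sup>2 / (a / 4)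
      + (c - u se)\<^sup>2 / (b / 4) + (c - u nw)\<^sup>2 / (b / 4)"
  by (simp add: star_energy_def add_divide_distrib power2_commute[of c])

text \<open>Reducing every arm to a single resistor leaves a star around the central hub.\<close>

lemma hub_energy_ge:
  assumes "eyebolted I" "a > 0" "b > 0"
  shows "star_energy (9 * a) (next_b a b) u (h (0, 0)) \<le> hub_energy I a b h u"
proof -
  obtain D E D' E' where N: "hub_energy I a b h u = arms_energy D E D' E' a b h u"
    using hub_energy_arms[OF assms(1)] by metis
  show ?thesis
    unfolding N arms_energy_def star_energy_arms
    by (intro add_mono plain_arm_ge eyebolt_arm_ge assms)
qed

text \<open>The bound is attained: once the central potential is fixed the arms are independent, so the
  optimal potentials of the four arms can be combined.\<close>

lemma hub_energy_eq:
  assumes "eyebolted I" "a > 0" "b > 0"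
  obtains h where "hub_energy I a b h u = star_energy (9 * a) (next_b a b) u c"
proof -
  obtain D E D' E' where
    DE: "fst D - snd D = 4" "fst E - snd E = 6" "fst D' - snd D' = -4" "fst E' - snd E' = -6"
      "\<And>i. i \<in> {D, E, D', E'} \<Longrightarrow> fst i + snd i \<noteq> 0"
    and N: "\<And>h. hub_energy I a b h u = arms_energy D E D' E' a b h u"
    using hub_energy_arms[OF assms(1)] by metis
  obtain q1 q2 q3 q4 where q: "plain_arm a c q1 q2 q3 q4 (u sw) = (c - u sw)\<^sup>2 / (9 * a / 4)"
    using plain_arm_eq[OF assms(2)] .
  obtain r1 r2 r3 r4 where r: "plain_arm a c r1 r2 r3 r4 (u ne) = (c - u ne)\<^sup>2 / (9 * a / 4)"
    using plain_arm_eq[OF assms(2)] .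
  obtain s1 s2 s3 s4 sd se' where s: "eyebolt_arm a b c s1 s2 s3 s4 sd se' (u se)
      = (c - u se)\<^sup>2 / (next_b a b / 4)"
    using eyebolt_arm_eq[OF assms(2,3)] .
  obtain t1 t2 t3 t4 td te where t: "eyebolt_arm a b c t1 t2 t3 t4 td te (u nw)
      = (c - u nw)\<^sup>2 / (next_b a b / 4)"
    using eyebolt_arm_eq[OF assms(2,3)] .
  \<comment> \<open>The hubs on the diagonals are addressed by their first coordinate, those of the eyebolts
    by the difference of their coordinates, which is the same for both choices.\<close>
  define diag where "diag = (\<lambda>_::int. c)(-1 := q1, -2 := q2, -3 := q3, -4 := q4,
      1 := r1, 2 := r2, 3 := r3, 4 := r4)"
  define anti where "anti = (\<lambda>_::int. c)(1 := s1, 2 := s2, 3 := s3, 4 := s4,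
      -1 := t1, -2 := t2, -3 := t3, -4 := t4)"
  define eye where "eye = (\<lambda>_::int. c)(4 := sd, 6 := se', -4 := td, -6 := te)"
  define h where "h i = (if fst i = snd i then diag (fst i)
      else if fst i + snd i = 0 then anti (fst i) else eye (fst i - snd i))" for i :: index
  have hDE: "h D = sd" "h E = se'" "h D' = td" "h E' = te"
  proof -
    show "h D = sd" using DE(1) DE(5)[of D] by (auto simp: h_def eye_def)
    show "h E = se'" using DE(2) DE(5)[of E] by (auto simp: h_def eye_def)
    show "h D' = td" using DE(3) DE(5)[of D'] by (auto simp: h_def eye_def)
    show "h E' = te" using DE(4) DE(5)[of E'] by (auto simp: h_def eye_def)
  qed
  have hX: "h (0, 0) = c" 
      "h (-1, -1) = q1" "h (-2, -2) = q2" "h (-3, -3) = q3" "h (-4, -4) = q4"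
      "h (1, 1) = r1" "h (2, 2) = r2" "h (3, 3) = r3" "h (4, 4) = r4"
      "h (1, -1) = s1" "h (2, -2) = s2" "h (3, -3) = s3" "h (4, -4) = s4"
      "h (-1, 1) = t1" "h (-2, 2) = t2" "h (-3, 3) = t3" "h (-4, 4) = t4"
    by (simp_all add: h_def diag_def anti_def)
  show ?thesis
  proof (rule that[of h])
    show "hub_energy I a b h u = star_energy (9 * a) (next_b a b) u c"
      unfolding N arms_energy_def hDE hX q r s t star_energy_arms ..
  qed
qed


section \<open>From the hub network to the cells\<close>

text \<open>The energy of two equal half-links is at least that of the link they form; equality holds at the
  average, which is how \<open>end_value\<close> is chosen.\<close>

lemma half_square_le:
  fixes x y z :: real
  shows "(x - z)\<^sup>2 / 2 \<le> (y - x)\<^sup>2 + (y - z)\<^sup>2"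
proof -
  have "(y - x)\<^sup>2 + (y - z)\<^sup>2 - (x - z)\<^sup>2 / 2 = (x + z - 2 * y)\<^sup>2 / 2"
    by (simp add: power2_eq_square field_simps)
  moreover have "(x + z - 2 * y)\<^sup>2 / 2 \<ge> 0" by simp
  ultimately show ?thesis by linarith
qed

text \<open>Here \<open>s\<close> points to a neighbouring cell, \<open>g i\<close> is the potential at the corner of cell \<open>i\<close> in
  direction \<open>s\<close> and \<open>g' i\<close> the one at the opposite corner. The corners of either kind are either
  shared, or a corner of the large square (belonging to \<open>k1\<close> or \<open>k0\<close>), or loose ends. In the second
  equation the shared corners are indexed by the other cell, so that the two sums over \<open>E\<close> can be
  added term by term.\<close>

lemma shift_end_sums:
  fixes h g g' :: "index \<Rightarrow> real" and s :: index
  assumes fin: "finite I" and k1: "k1 \<in> I" "k1 + s \<notin> I" and k0: "k0 \<in> I" "k0 - s \<notin> I"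
  defines "E \<equiv> {i. i \<in> I \<and> i + s \<in> I}"
  shows "(\<Sum>i\<in>I. (g i - h i)\<^sup>2) = (\<Sum>i\<in>E. (g i - h i)\<^sup>2) + (g k1 - h k1)\<^sup>2
      + (\<Sum>i | i \<in> I \<and> i + s \<notin> I \<and> i \<noteq> k1. (g i - h i)\<^sup>2)"
    and "(\<Sum>i\<in>I. (g' i - h i)\<^sup>2) = (\<Sum>i\<in>E. (g' (i + s) - h (i + s))\<^sup>2) + (g' k0 - h k0)\<^sup>2
      + (\<Sum>i | i \<in> I \<and> i - s \<notin> I \<and> i \<noteq> k0. (g' i - h i)\<^sup>2)"
proof -
  have 1: "I = insert k1 E \<union> {i. i \<in> I \<and> i + s \<notin> I \<and> i \<noteq> k1}"
    using k1 by (auto simp: E_def)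
  have finE: "finite E" using fin by (simp add: E_def)
  show "(\<Sum>i\<in>I. (g i - h i)\<^sup>2) = (\<Sum>i\<in>E. (g i - h i)\<^sup>2) + (g k1 - h k1)\<^sup>2
      + (\<Sum>i | i \<in> I \<and> i + s \<notin> I \<and> i \<noteq> k1. (g i - h i)\<^sup>2)"
    by (subst 1, subst sum.union_disjoint) (use fin finE k1 in \<open>auto simp: E_def\<close>)
  have 2: "I = insert k0 ((\<lambda>i. i + s) ` E) \<union> {i. i \<in> I \<and> i - s \<notin> I \<and> i \<noteq> k0}"
  proof
    show "I \<subseteq> insert k0 ((\<lambda>i. i + s) ` E) \<union> {i. i \<in> I \<and> i - s \<notin> I \<and> i \<noteq> k0}"
    proof
      fix i assume "i \<in> I"
      then have "i \<in> (\<lambda>i. i + s) ` E" if "i - s \<in> I"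
        using that by (intro image_eqI[of _ _ "i - s"]) (simp_all add: E_def)
      with \<open>i \<in> I\<close> show "i \<in> insert k0 ((\<lambda>i. i + s) ` E) \<union> {i. i \<in> I \<and> i - s \<notin> I \<and> i \<noteq> k0}"
        by auto
    qed
  qed (use k0 in \<open>auto simp: E_def\<close>)
  have k0E: "k0 \<notin> (\<lambda>i. i + s) ` E" using k0 by (auto simp: E_def)
  have "(\<Sum>i\<in>I. (g' i - h i)\<^sup>2) = (\<Sum>i\<in>insert k0 ((\<lambda>i. i + s) ` E). (g' i - h i)\<^sup>2)
      + (\<Sum>i | i \<in> I \<and> i - s \<notin> I \<and> i \<noteq> k0. (g' i - h i)\<^sup>2)"
    by (subst 2, subst sum.union_disjoint) (use fin finE k0 in \<open>auto simp: E_def\<close>)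
  also have "(\<Sum>i\<in>insert k0 ((\<lambda>i. i + s) ` E). (g' i - h i)\<^sup>2)
      = (\<Sum>i\<in>E. (g' (i + s) - h (i + s))\<^sup>2) + (g' k0 - h k0)\<^sup>2"
    using finE k0E by (simp add: sum.reindex inj_on_def)
  finally show "(\<Sum>i\<in>I. (g' i - h i)\<^sup>2) = (\<Sum>i\<in>E. (g' (i + s) - h (i + s))\<^sup>2) + (g' k0 - h k0)\<^sup>2
      + (\<Sum>i | i \<in> I \<and> i - s \<notin> I \<and> i \<noteq> k0. (g' i - h i)\<^sup>2)" .
qed

text \<open>Both half-links of a link meet in the shared corner; loose ends can only add energy.\<close>

lemma opposite_ends_ge:
  fixes h g g' :: "index \<Rightarrow> real" and s :: index
  assumes "finite I" "k1 \<in> I" "k1 + s \<notin> I" "k0 \<in> I" "k0 - s \<notin> I"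
    and glue: "\<And>i. i \<in> I \<Longrightarrow> i + s \<in> I \<Longrightarrow> g' (i + s) = g i"
  shows "(\<Sum>i | i \<in> I \<and> i + s \<in> I. (h i - h (i + s))\<^sup>2) / 2 + (g k1 - h k1)\<^sup>2 + (g' k0 - h k0)\<^sup>2
      \<le> (\<Sum>i\<in>I. (g i - h i)\<^sup>2) + (\<Sum>i\<in>I. (g' i - h i)\<^sup>2)"
proof -
  let ?E = "{i. i \<in> I \<and> i + s \<in> I}"
  have "(\<Sum>i\<in>?E. (h i - h (i + s))\<^sup>2) / 2
      \<le> (\<Sum>i\<in>?E. (g i - h i)\<^sup>2 + (g' (i + s) - h (i + s))\<^sup>2)"
    unfolding sum_divide_distrib by (intro sum_mono) (use glue half_square_le in simp)
  moreover have "(\<Sum>i | i \<in> I \<and> i + s \<notin> I \<and> i \<noteq> k1. (g i - h i)\<^sup>2) \<ge> 0"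
    "(\<Sum>i | i \<in> I \<and> i - s \<notin> I \<and> i \<noteq> k0. (g' i - h i)\<^sup>2) \<ge> 0"
    by (simp_all add: sum_nonneg)
  ultimately show ?thesis
    unfolding shift_end_sums(1)[OF assms(1-5), of g h] shift_end_sums(2)[OF assms(1-5), of g' h]
      sum.distrib by linarith
qed

text \<open>The optimal potential at the corner of cell \<open>i\<close> in direction \<open>s\<close>: the average of the two hubs at
  a shared corner, the prescribed value \<open>x\<close> at the corner of the large square, and the potential of
  the hub at a loose end, where no current flows.\<close>

definition end_value ::
  "index set \<Rightarrow> (index \<Rightarrow> real) \<Rightarrow> index \<Rightarrow> index \<Rightarrow> real \<Rightarrow> index \<Rightarrow> real" where
  "end_value I h s k x i =
     (if i + s \<in> I then (h i + h (i + s)) / 2 else if i = k then x else h i)"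

lemma opposite_ends_eq:
  fixes h :: "index \<Rightarrow> real" and s :: index
  assumes "finite I" "k1 \<in> I" "k1 + s \<notin> I" "k0 \<in> I" "k0 - s \<notin> I"
  shows "(\<Sum>i\<in>I. (end_value I h s k1 x i - h i)\<^sup>2) + (\<Sum>i\<in>I. (end_value I h (- s) k0 y i - h i)\<^sup>2)
    = (\<Sum>i | i \<in> I \<and> i + s \<in> I. (h i - h (i + s))\<^sup>2) / 2 + (h k1 - x)\<^sup>2 + (h k0 - y)\<^sup>2"
proof -
  let ?E = "{i. i \<in> I \<and> i + s \<in> I}" and ?g = "end_value I h s k1 x" and ?g' = "end_value I h (- s) k0 y"
  have "(\<Sum>i | i \<in> I \<and> i + s \<notin> I \<and> i \<noteq> k1. (?g i - h i)\<^sup>2) = 0"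
    "(\<Sum>i | i \<in> I \<and> i - s \<notin> I \<and> i \<noteq> k0. (?g' i - h i)\<^sup>2) = 0"
    by (auto intro!: sum.neutral simp: end_value_def)
  moreover have "(\<Sum>i\<in>?E. (?g i - h i)\<^sup>2 + (?g' (i + s) - h (i + s))\<^sup>2)
      = (\<Sum>i\<in>?E. (h i - h (i + s))\<^sup>2) / 2"
    unfolding sum_divide_distrib
    by (intro sum.cong refl) (simp add: end_value_def, simp add: power2_eq_square field_simps)
  moreover have "?g k1 = x" "?g' k0 = y"
    using assms by (simp_all add: end_value_def)
  ultimately show ?thesis
    unfolding shift_end_sums(1)[OF assms, of ?g h] shift_end_sums(2)[OF assms, of ?g' h]
      sum.distrib
    by (simp add: power2_commute[of x] power2_commute[of y])
qed

text \<open>The outermost cells, in the form in which they enter \<open>opposite_ends_ge\<close> as \<open>k1\<close> and \<open>k0\<close>.\<close>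

lemma eyebolted_tips:
  assumes "eyebolted I"
  shows "(4, 4) \<in> I" "(4, 4) + (1, 1) \<notin> I" "(-4, -4) \<in> I" "(-4, -4) - (1, 1) \<notin> I"
    "(-4, 4) \<in> I" "(-4, 4) + (-1, 1) \<notin> I" "(4, -4) \<in> I" "(4, -4) - (-1, 1) \<notin> I"
proof -
  obtain D E D' E' where I: "I = {(-4, -4), (-3, -3), (-2, -2), (-1, -1), (0, 0), (1, 1), (2, 2), (3, 3), (4, 4),
      (-4, 4), (-3, 3), (-2, 2), (-1, 1), (1, -1), (2, -2), (3, -3), (4, -4), D, E, D', E'}"
    using eyebolted_explicit[OF assms] .
  show "(4, 4) \<in> I" "(-4, -4) \<in> I" "(-4, 4) \<in> I" "(4, -4) \<in> I"
    unfolding I by (simp_all only: insert_iff simp_thms)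
qed (use eyebolted_bounds[OF assms] in fastforce)+

text \<open>The cells lie on one colour of a checkerboard, so two of them never share an edge; this is why
  different cells meet in at most one point.\<close>

lemma eyebolted_even:
  assumes "eyebolted I" "i \<in> I" shows "even (fst i + snd i)"
proof -
  obtain D E D' E' where DE: "(D, E) \<in> {((3, -1), (4, -2)), ((1, -3), (2, -4))}"
    "(D', E') \<in> {((-3, 1), (-4, 2)), ((-1, 3), (-2, 4))}"
    and I: "I = {(-4, -4), (-3, -3), (-2, -2), (-1, -1), (0, 0), (1, 1), (2, 2), (3, 3), (4, 4),
      (-4, 4), (-3, 3), (-2, 2), (-1, 1), (1, -1), (2, -2), (3, -3), (4, -4), D, E, D', E'}"
    using eyebolted_explicit[OF assms(1)] .
  have "even (fst j + snd j)" if "j \<in> {D, E, D', E'}" for j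
    using DE that by auto
  then show ?thesis using assms(2) unfolding I by (elim insertE emptyE) simp_all
qed

lemma sum_star_energy:
  "(\<Sum>i\<in>I. star_energy a b (g i) (h i)) =
     ((\<Sum>i\<in>I. (g i ne - h i)\<^sup>2) + (\<Sum>i\<in>I. (g i sw - h i)\<^sup>2)) / (a / 4)
     + ((\<Sum>i\<in>I. (g i nw - h i)\<^sup>2) + (\<Sum>i\<in>I. (g i se - h i)\<^sup>2)) / (b / 4)"
  by (simp add: star_energy_def sum.distrib sum_divide_distrib[symmetric]
      sum_distrib_right[symmetric] add_ac)

text \<open>The hypotheses say that the corner potentials \<open>g i\<close> of the cells come from one function: they
  agree at shared corners and have boundary values \<open>u\<close>.\<close>

lemma hub_energy_le_stars:
  assumes I: "eyebolted I" and "a > 0" "b > 0"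
    and glue: "\<And>i. i \<in> I \<Longrightarrow> i + (1, 1) \<in> I \<Longrightarrow> g (i + (1, 1)) sw = g i ne"
      "\<And>i. i \<in> I \<Longrightarrow> i + (-1, 1) \<in> I \<Longrightarrow> g (i + (-1, 1)) se = g i nw"
    and tips: "g (4, 4) ne = u ne" "g (-4, -4) sw = u sw" "g (-4, 4) nw = u nw" "g (4, -4) se = u se"
  shows "hub_energy I a b h u \<le> (\<Sum>i\<in>I. star_energy a b (g i) (h i))"
proof -
  note tip = eyebolted_tips[OF I] and fin = eyebolted_finite[OF I]
  let ?S = "\<lambda>s. \<Sum>i | i \<in> I \<and> i + s \<in> I. (h i - h (i + s))\<^sup>2"
  have "hub_energy I a b h u =
      (?S (1, 1) / 2 + (g (4, 4) ne - h (4, 4))\<^sup>2 + (g (-4, -4) sw - h (-4, -4))\<^sup>2) / (a / 4)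
      + (?S (-1, 1) / 2 + (g (-4, 4) nw - h (-4, 4))\<^sup>2 + (g (4, -4) se - h (4, -4))\<^sup>2) / (b / 4)"
    unfolding hub_energy_def tips
    by (simp add: add_divide_distrib power2_commute[of "h _" "u _"] mult.commute)
  also have "\<dots> \<le> (\<Sum>i\<in>I. star_energy a b (g i) (h i))"
    unfolding sum_star_energy
    by (intro add_mono divide_right_mono opposite_ends_ge fin tip glue)
      (use assms in simp_all)
  finally show ?thesis .
qed

definition corner_values ::
  "index set \<Rightarrow> (index \<Rightarrow> real) \<Rightarrow> (point \<Rightarrow> real) \<Rightarrow> index \<Rightarrow> point \<Rightarrow> real" where
  "corner_values I h u i p =
     (if p = ne then end_value I h (1, 1) (4, 4) (u ne) i
      else if p = sw then end_value I h (-1, -1) (-4, -4) (u sw) i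
      else if p = nw then end_value I h (-1, 1) (-4, 4) (u nw) i
      else end_value I h (1, -1) (4, -4) (u se) i)"

lemma hub_energy_eq_stars:
  assumes I: "eyebolted I"
  shows "(\<Sum>i\<in>I. star_energy a b (corner_values I h u i) (h i)) = hub_energy I a b h u"
proof -
  note tip = eyebolted_tips[OF I] and fin = eyebolted_finite[OF I]
  have neg: "- (1, 1) = (-1, -1 :: int)" "- (-1, 1) = (1 :: int, -1 :: int)" by simp_all
  show ?thesis
    unfolding sum_star_energy hub_energy_def
    using opposite_ends_eq[OF fin tip(1-4), of h "u ne" "u sw"]
      opposite_ends_eq[OF fin tip(5-8), of h "u nw" "u se"]
    unfolding neg by (simp add: corner_values_def add_divide_distrib mult.commute)
qed

lemma corner_values_glue:
  assumes "i \<in> I" "i + (1, 1) \<in> I"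
  shows "corner_values I h u (i + (1, 1)) sw = corner_values I h u i ne"
  using assms by (cases i) (simp add: corner_values_def end_value_def)

lemma corner_values_glue':
  assumes "i \<in> I" "i + (-1, 1) \<in> I"
  shows "corner_values I h u (i + (-1, 1)) se = corner_values I h u i nw"
  using assms by (cases i) (simp add: corner_values_def end_value_def)

lemma corner_values_tips:
  assumes "eyebolted I"
  shows "corner_values I h u (4, 4) ne = u ne" "corner_values I h u (-4, -4) sw = u sw"
    "corner_values I h u (-4, 4) nw = u nw" "corner_values I h u (4, -4) se = u se"
  using eyebolted_tips[OF assms] by (simp_all add: corner_values_def end_value_def)

lemma F_shared_corner:
  "F i ne = F (i + (1, 1)) sw" "F i nw = F (i + (-1, 1)) se"
  by (simp_all add: F_def corner_defs field_simps)

lemma F_tips: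
  "F (4, 4) ne = ne" "F (-4, -4) sw = sw" "F (-4, 4) nw = nw" "F (4, -4) se = se"
  by (simp_all add: F_def corner_defs field_simps)

lemma inj_F: "inj (F i)"
  by (rule injI) (simp add: F_def)

section \<open>Self-similarity of the energy\<close>

text \<open>The first letter of a word selects the largest cell.\<close>

lemma energy_Suc:
  assumes "finite I"
  shows "energy I (Suc n) v = (\<Sum>i\<in>I. energy I n (\<lambda>x. v (F i x)))"
proof -
  have words: "words I (Suc n) = (\<lambda>(i, w). i # w) ` (I \<times> words I n)"
    by (auto simp: words_def length_Suc_conv image_iff)
  have cell: "pair_energy (V_word (i # w)) (\<lambda>_ _. 1) v
      = pair_energy (V_word w) (\<lambda>_ _. 1) (\<lambda>x. v (F i x))" for i w
  proof -
    have "V_word (i # w) = F i ` V_word w"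
      by (simp add: V_word_def F_word_def image_image)
    moreover have "inj_on (F i) (V_word w)" using inj_F by (rule inj_on_subset) simp
    ultimately show ?thesis by (simp add: pair_energy_def sum.reindex)
  qed
  have "energy I (Suc n) v = (\<Sum>(i, w)\<in>I \<times> words I n. pair_energy (V_word (i # w)) (\<lambda>_ _. 1) v)"
    unfolding energy_def words by (subst sum.reindex) (auto simp: inj_on_def case_prod_beta)
  also have "\<dots> = (\<Sum>i\<in>I. energy I n (\<lambda>x. v (F i x)))"
    by (simp add: sum.cartesian_product[symmetric] cell energy_def)
  finally show ?thesis .
qed

lemma pair_energy_V0:
  assumes "\<And>p q. p \<in> V0 \<Longrightarrow> q \<in> V0 \<Longrightarrow> c p q = c q p"
  shows "pair_energy V0 c u =
     c sw se * (u sw - u se)\<^sup>2 + c se ne * (u se - u ne)\<^sup>2 + c ne nw * (u ne - u nw)\<^sup>2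
     + c nw sw * (u nw - u sw)\<^sup>2 + c sw ne * (u sw - u ne)\<^sup>2 + c se nw * (u se - u nw)\<^sup>2"
proof -
  have "c se sw = c sw se" "c ne se = c se ne" "c nw ne = c ne nw" "c sw nw = c nw sw"
    "c ne sw = c sw ne" "c nw se = c se nw"
    using assms by (simp_all add: V0_eq)
  then show ?thesis
    unfolding pair_energy_def V0_eq
    by (simp add: power2_commute[of "u se" "u sw"] power2_commute[of "u ne" "u se"]
        power2_commute[of "u nw" "u ne"] power2_commute[of "u sw" "u nw"]
        power2_commute[of "u ne" "u sw"] power2_commute[of "u nw" "u se"])
qed

text \<open>A complete graph with unit resistances has the trace of the star with four arms \<open>1/4\<close>.\<close>

lemma energy_0: "energy I 0 v = cell_form 1 1 v"
proof -
  have "words I 0 = {[]}" by (auto simp: words_def)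
  then show ?thesis
    by (simp add: energy_def V_word_def F_word_def pair_energy_V0 cell_form_def)
      (simp add: power2_eq_square algebra_simps)
qed

lemma energy_cong:
  assumes "finite I" "\<And>x. x \<in> V I n \<Longrightarrow> u x = v x"
  shows "energy I n u = energy I n v"
  using assms(2)
proof (induction n arbitrary: u v)
  case 0
  then show ?case unfolding energy_0 by (intro cell_form_cong) simp
next
  case (Suc n)
  have "energy I n (\<lambda>x. u (F i x)) = energy I n (\<lambda>x. v (F i x))" if "i \<in> I" for i
    by (rule Suc.IH, rule Suc.prems) (use that in auto)
  then show ?case unfolding energy_Suc[OF assms(1)] by (intro sum.cong refl)
qed

section \<open>Gluing functions on the cells\<close>

definition square :: "point set" where
  "square = {-1/2..1/2} \<times> {-1/2..1/2}"

lemma V_subset_square: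
  assumes "eyebolted I" shows "V I n \<subseteq> square"
proof (induction n)
  case 0
  show ?case by (auto simp: V0_eq corner_defs square_def)
next
  case (Suc n)
  have "F i x \<in> square" if "i \<in> I" "x \<in> square" for i x
  proof -
    have "\<bar>real_of_int (fst i)\<bar> \<le> 4" "\<bar>real_of_int (snd i)\<bar> \<le> 4"
      using eyebolted_bounds[OF assms that(1)] by linarith+
    then show ?thesis using that(2)
      by (cases x) (auto simp: square_def F_def field_simps abs_le_iff)
  qed
  then show ?case using Suc by auto
qed

lemma V0_subset_V:
  assumes "eyebolted I" shows "V0 \<subseteq> V I n"
proof (induction n)
  case (Suc n)
  then have "sw \<in> V I n" "se \<in> V I n" "ne \<in> V I n" "nw \<in> V I n" by (simp_all add: V0_eq)
  then have "F (-4, -4) sw \<in> V I (Suc n)" "F (4, -4) se \<in> V I (Suc n)"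
    "F (4, 4) ne \<in> V I (Suc n)" "F (-4, 4) nw \<in> V I (Suc n)"
    using eyebolted_tips[OF assms] by auto
  then show ?case by (simp add: F_tips V0_eq)
qed simp

text \<open>The indices of touching cells differ by at most 1 in each coordinate, and by the parity of
  cells either in both coordinates or in none. A difference of 1 forces the point to be on opposite
  sides of the two squares.\<close>

lemma cells_touch:
  assumes I: "eyebolted I" and i: "i \<in> I" and j: "j \<in> I"
    and x: "x \<in> square" and y: "y \<in> square" and eq: "F i x = F j y"
  obtains "j = i" "x = y"
  | "j = i + (1, 1)" "x = ne" "y = sw" | "i = j + (1, 1)" "x = sw" "y = ne"
  | "j = i + (-1, 1)" "x = nw" "y = se" | "i = j + (-1, 1)" "x = se" "y = nw"
proof -
  have d: "fst x - fst y = of_int (fst j - fst i)" "snd x - snd y = of_int (snd j - snd i)"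
    using eq by (simp_all add: F_def prod_eq_iff field_simps)
  have b: "\<bar>fst x\<bar> \<le> 1/2" "\<bar>fst y\<bar> \<le> 1/2" "\<bar>snd x\<bar> \<le> 1/2" "\<bar>snd y\<bar> \<le> 1/2"
    using x y by (auto simp: square_def abs_le_iff)
  have "\<bar>of_int (fst j - fst i) :: real\<bar> \<le> 1" "\<bar>of_int (snd j - snd i) :: real\<bar> \<le> 1"
    using b unfolding d[symmetric] by linarith+
  then have n: "\<bar>fst j - fst i\<bar> \<le> 1" "\<bar>snd j - snd i\<bar> \<le> 1" by linarith+
  have "even ((fst j + snd j) - (fst i + snd i))"
    using eyebolted_even[OF I i] eyebolted_even[OF I j] by simp
  then have "even ((fst j - fst i) + (snd j - snd i))" by (simp add: algebra_simps)
  moreover have "k = -1 \<or> k = 0 \<or> k = 1" if "\<bar>k\<bar> \<le> 1" for k :: int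
    using that by linarith
  from this[OF n(1)] this[OF n(2)]
  have "fst j - fst i = -1 \<or> fst j - fst i = 0 \<or> fst j - fst i = 1"
    "snd j - snd i = -1 \<or> snd j - snd i = 0 \<or> snd j - snd i = 1" .
  ultimately consider "fst j - fst i = 0" "snd j - snd i = 0"
    | "fst j - fst i = 1" "snd j - snd i = 1" | "fst j - fst i = -1" "snd j - snd i = -1"
    | "fst j - fst i = -1" "snd j - snd i = 1" | "fst j - fst i = 1" "snd j - snd i = -1"
    by (elim disjE) simp_all
  then show ?thesis
  proof cases
    case 1
    with d show ?thesis by (intro that(1)) (auto simp: prod_eq_iff)
  next
    case 2
    with d b show ?thesis by (intro that(2)) (auto simp: prod_eq_iff corner_defs)
  next
    case 3
    with d b show ?thesis by (intro that(3)) (auto simp: prod_eq_iff corner_defs)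
  next
    case 4
    with d b show ?thesis by (intro that(4)) (auto simp: prod_eq_iff corner_defs)
  next
    case 5
    with d b show ?thesis by (intro that(5)) (auto simp: prod_eq_iff corner_defs)
  qed
qed

text \<open>Compatibility at the shared corners suffices since cells meet nowhere else.\<close>

lemma glue_cells:
  fixes m :: "index \<Rightarrow> point \<Rightarrow> real"
  assumes I: "eyebolted I"
    and glue: "\<And>i. i \<in> I \<Longrightarrow> i + (1, 1) \<in> I \<Longrightarrow> m (i + (1, 1)) sw = m i ne"
      "\<And>i. i \<in> I \<Longrightarrow> i + (-1, 1) \<in> I \<Longrightarrow> m (i + (-1, 1)) se = m i nw"
  shows "\<exists>v. \<forall>i\<in>I. \<forall>x\<in>V I n. v (F i x) = m i x"
proof -
  have wd: "m i x = m j y"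
    if "i \<in> I" "x \<in> V I n" "j \<in> I" "y \<in> V I n" "F i x = F j y" for i j x y
  proof -
    have "x \<in> square" "y \<in> square" using that V_subset_square[OF I] by auto
    then show ?thesis
      using that(1,3) glue by (cases rule: cells_touch[OF I that(1,3) _ _ that(5)]) auto
  qed
  define P where "P z t \<longleftrightarrow> fst t \<in> I \<and> snd t \<in> V I n \<and> F (fst t) (snd t) = z" for z t
  define v where "v z = (let t = SOME t. P z t in m (fst t) (snd t))" for z
  show ?thesis
  proof (intro exI[of _ v] ballI)
    fix i x assume "i \<in> I" "x \<in> V I n"
    then have "P (F i x) (i, x)" by (simp add: P_def)
    then have "P (F i x) (SOME t. P (F i x) t)" by (rule someI)
    then show "v (F i x) = m i x"
      unfolding v_def Let_def P_def using \<open>i \<in> I\<close> \<open>x \<in> V I n\<close> by (intro wd) auto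
  qed
qed

section \<open>The trace on the four corners\<close>

lemma next_b_bounds:
  assumes "a > 0" "b > 0"
  shows "8 * b \<le> next_b a b" "next_b a b \<le> 9 * b"
proof -
  have "b\<^sup>2 / (a + b) \<le> b" "b\<^sup>2 / (a + b) \<ge> 0"
    using assms by (simp_all add: divide_simps power2_eq_square)
  then show "8 * b \<le> next_b a b" "next_b a b \<le> 9 * b" unfolding next_b_def by linarith+
qed

text \<open>Giving each cell its optimal hub turns the cells into stars without changing their energy, and
  the stars have at least the energy of the hub network, which reduces to the large star.\<close>

lemma trace_step_ge:
  assumes I: "eyebolted I" and ab: "a > 0" "b > 0"
  shows "cell_form (9 * a) (next_b a b) v \<le> (\<Sum>i\<in>I. cell_form a b (\<lambda>x. v (F i x)))"
proof -
  have "\<exists>c. star_energy a b (\<lambda>x. v (F i x)) c = cell_form a b (\<lambda>x. v (F i x))" for i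
    using cell_form_eq_star_energy[OF ab] by metis
  then obtain h where h: "\<And>i. star_energy a b (\<lambda>x. v (F i x)) (h i) = cell_form a b (\<lambda>x. v (F i x))"
    by metis
  have "next_b a b > 0" using next_b_bounds[OF ab] ab by linarith
  then have "cell_form (9 * a) (next_b a b) v \<le> star_energy (9 * a) (next_b a b) v (h (0, 0))"
    using ab by (intro cell_form_le_star_energy) auto
  also have "\<dots> \<le> hub_energy I a b h v"
    by (rule hub_energy_ge[OF I ab])
  also have "\<dots> \<le> (\<Sum>i\<in>I. star_energy a b (\<lambda>x. v (F i x)) (h i))"
    by (intro hub_energy_le_stars I ab) (simp_all only: F_shared_corner[symmetric] F_tips)
  finally show ?thesis by (simp only: h)
qed

text \<open>Optimal hub potentials of the large star and of the arms produce corner values for which the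
  estimate of the previous lemma is sharp.\<close>

lemma trace_step_le:
  assumes I: "eyebolted I" and ab: "a > 0" "b > 0"
  obtains h where
    "(\<Sum>i\<in>I. cell_form a b (corner_values I h u i)) \<le> cell_form (9 * a) (next_b a b) u"
proof -
  have nb: "9 * a > 0" "next_b a b > 0" using next_b_bounds[OF ab] ab by linarith+
  obtain c where c: "star_energy (9 * a) (next_b a b) u c = cell_form (9 * a) (next_b a b) u"
    using cell_form_eq_star_energy[OF nb] .
  obtain h where h: "hub_energy I a b h u = star_energy (9 * a) (next_b a b) u c"
    using hub_energy_eq[OF I ab] .
  have "(\<Sum>i\<in>I. cell_form a b (corner_values I h u i))
      \<le> (\<Sum>i\<in>I. star_energy a b (corner_values I h u i) (h i))"
    by (intro sum_mono cell_form_le_star_energy ab)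
  then show ?thesis
    by (intro that[of h]) (simp only: hub_energy_eq_stars[OF I] h c)
qed

context
  fixes b :: "nat \<Rightarrow> real"
  assumes b_0: "b 0 = 1" and b_Suc: "\<And>n. b (Suc n) = next_b (9 ^ n) (b n)"
begin

lemma b_bounds: "0 < b n" "b n \<le> 9 ^ n"
proof -
  have "0 < b n \<and> b n \<le> 9 ^ n"
  proof (induction n)
    case (Suc n)
    then show ?case using next_b_bounds[of "9 ^ n" "b n"] by (simp add: b_Suc)
  qed (simp add: b_0)
  then show "0 < b n" "b n \<le> 9 ^ n" by simp_all
qed

lemma energy_ge_cell_form:
  assumes I: "eyebolted I"
  shows "cell_form (9 ^ n) (b n) v \<le> energy I n v"
proof (induction n arbitrary: v)
  case 0
  show ?case by (simp add: energy_0 b_0)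
next
  case (Suc n)
  have "cell_form (9 ^ Suc n) (b (Suc n)) v \<le> (\<Sum>i\<in>I. cell_form (9 ^ n) (b n) (\<lambda>x. v (F i x)))"
    using trace_step_ge[OF I _ b_bounds(1), of "9 ^ n"] by (simp add: b_Suc)
  also have "\<dots> \<le> energy I (Suc n) v"
    unfolding energy_Suc[OF eyebolted_finite[OF I]] by (intro sum_mono Suc.IH)
  finally show ?case .
qed

text \<open>The minimizers of the 21 cells, for the optimal corner values, are glued to a minimizer on the next
  level.\<close>

lemma energy_attains_cell_form:
  assumes I: "eyebolted I"
  shows "\<exists>v. (\<forall>p\<in>V0. v p = u p) \<and> energy I n v \<le> cell_form (9 ^ n) (b n) u"
proof (induction n arbitrary: u)
  case 0
  show ?case by (auto simp: energy_0 b_0)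
next
  case (Suc n)
  have "9 ^ n > (0 :: real)" by simp
  then obtain h where "(\<Sum>i\<in>I. cell_form (9 ^ n) (b n) (corner_values I h u i))
      \<le> cell_form (9 * 9 ^ n) (next_b (9 ^ n) (b n)) u"
    using trace_step_le[OF I _ b_bounds(1)] by blast
  then have h: "(\<Sum>i\<in>I. cell_form (9 ^ n) (b n) (corner_values I h u i))
      \<le> cell_form (9 ^ Suc n) (b (Suc n)) u"
    by (simp only: b_Suc power_Suc)
  let ?c = "corner_values I h u"
  have "\<forall>i. \<exists>v. (\<forall>p\<in>V0. v p = ?c i p) \<and> energy I n v \<le> cell_form (9 ^ n) (b n) (?c i)"
    by (intro allI Suc.IH)
  from choice[OF this] obtain m where m: "\<And>i p. p \<in> V0 \<Longrightarrow> m i p = ?c i p"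
    and m_le: "\<And>i. energy I n (m i) \<le> cell_form (9 ^ n) (b n) (?c i)"
    by blast
  have in_V0: "sw \<in> V0" "se \<in> V0" "ne \<in> V0" "nw \<in> V0" by (simp_all add: V0_eq)
  have "m (i + (1, 1)) sw = m i ne" if "i \<in> I" "i + (1, 1) \<in> I" for i
    using that by (simp only: m in_V0 corner_values_glue)
  moreover have "m (i + (-1, 1)) se = m i nw" if "i \<in> I" "i + (-1, 1) \<in> I" for i
    using that by (simp only: m in_V0 corner_values_glue')
  ultimately have "\<exists>v. \<forall>i\<in>I. \<forall>x\<in>V I n. v (F i x) = m i x"
    by (rule glue_cells[OF I])
  then obtain v where v: "\<And>i x. i \<in> I \<Longrightarrow> x \<in> V I n \<Longrightarrow> v (F i x) = m i x"
    by blast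
  \<comment> \<open>Corners of the large square are corners of the outermost cells, hence keep their values.\<close>
  have vc: "v (F i p) = ?c i p" if "i \<in> I" "p \<in> V0" for i p
    using v[OF that(1)] m[OF that(2)] that(2) V0_subset_V[OF I, of n] by (metis subsetD)
  note tips = eyebolted_tips(1,3,5,7)[OF I]
  have "v ne = u ne" "v sw = u sw" "v nw = u nw" "v se = u se"
    using vc[OF tips(1) in_V0(3)] vc[OF tips(2) in_V0(1)] vc[OF tips(3) in_V0(4)]
      vc[OF tips(4) in_V0(2)]
    by (simp_all only: F_tips corner_values_tips[OF I])
  then have "\<forall>p\<in>V0. v p = u p" by (simp add: V0_eq)
  moreover have "energy I (Suc n) v \<le> cell_form (9 ^ Suc n) (b (Suc n)) u"
  proof -
    have "energy I n (\<lambda>x. v (F i x)) \<le> cell_form (9 ^ n) (b n) (?c i)" if "i \<in> I" for i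
      using m_le[of i] energy_cong[OF eyebolted_finite[OF I], of n "\<lambda>x. v (F i x)" "m i"] v[OF that]
      by simp
    from sum_mono[OF this] show ?thesis
      unfolding energy_Suc[OF eyebolted_finite[OF I]] using h by (rule order_trans)
  qed
  ultimately show ?case by blast
qed

lemma is_minimum_cell_form:
  assumes I: "eyebolted I"
  shows "is_minimum (cell_form (9 ^ n) (b n) u)
    {energy I n v | v. v \<in> V I n \<rightarrow>\<^sub>E UNIV \<and> (\<forall>p\<in>V0. v p = u p)}"
  unfolding is_minimum_def
proof (intro conjI ballI)
  have ge: "cell_form (9 ^ n) (b n) u \<le> energy I n v" if "\<forall>p\<in>V0. v p = u p" for v
    using energy_ge_cell_form[OF I, of n v] cell_form_cong[of v u "9 ^ n" "b n"] that by simp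
  then show "cell_form (9 ^ n) (b n) u \<le> s"
    if "s \<in> {energy I n v | v. v \<in> V I n \<rightarrow>\<^sub>E UNIV \<and> (\<forall>p\<in>V0. v p = u p)}" for s
    using that by auto
  obtain v where v: "\<And>p. p \<in> V0 \<Longrightarrow> v p = u p" "energy I n v \<le> cell_form (9 ^ n) (b n) u"
    using energy_attains_cell_form[OF I, of u n] by blast
  define w where "w = restrict v (V I n)"
  have w: "\<forall>p\<in>V0. w p = u p" using v V0_subset_V[OF I] by (auto simp: w_def)
  have "energy I n w = energy I n v"
    by (rule energy_cong[OF eyebolted_finite[OF I]]) (simp add: w_def)
  then have "energy I n w = cell_form (9 ^ n) (b n) u" using ge[OF w] v(2) by simp
  moreover have "w \<in> V I n \<rightarrow>\<^sub>E UNIV" by (simp add: w_def)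
  ultimately show "cell_form (9 ^ n) (b n) u
      \<in> {energy I n v | v. v \<in> V I n \<rightarrow>\<^sub>E UNIV \<and> (\<forall>p\<in>V0. v p = u p)}"
    using w by (intro CollectI exI[of _ w]) simp
qed

lemma is_trace_iff:
  assumes I: "eyebolted I"
  shows "is_trace I n R \<longleftrightarrow> (\<forall>p\<in>V0. \<forall>q\<in>V0. R p q = R q p)
    \<and> (\<forall>u. pair_energy V0 (\<lambda>p q. 1 / R p q) u = cell_form (9 ^ n) (b n) u)"
proof -
  have unique: "x = y" if "is_minimum x S" "is_minimum y S" for x y S
    using that unfolding is_minimum_def by (meson order_antisym)
  have key: "is_minimum x {energy I n v | v. v \<in> V I n \<rightarrow>\<^sub>E UNIV \<and> (\<forall>p\<in>V0. v p = u p)}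
      \<longleftrightarrow> x = cell_form (9 ^ n) (b n) u" for x u
  proof
    assume "is_minimum x {energy I n v | v. v \<in> V I n \<rightarrow>\<^sub>E UNIV \<and> (\<forall>p\<in>V0. v p = u p)}"
    then show "x = cell_form (9 ^ n) (b n) u"
      by (rule unique[OF _ is_minimum_cell_form[OF I]])
  next
    assume x: "x = cell_form (9 ^ n) (b n) u"
    show "is_minimum x {energy I n v | v. v \<in> V I n \<rightarrow>\<^sub>E UNIV \<and> (\<forall>p\<in>V0. v p = u p)}"
      unfolding x by (rule is_minimum_cell_form[OF I])
  qed
  show ?thesis unfolding is_trace_def key ..
qed

end

section \<open>Resistances\<close>

definition cell_resistance :: "real \<Rightarrow> real \<Rightarrow> point \<Rightarrow> point \<Rightarrow> real" where
  "cell_resistance a b p q =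
     (if {p, q} = {sw, ne} then (a + a\<^sup>2 / b) / 2
      else if {p, q} = {se, nw} then (b + b\<^sup>2 / a) / 2
      else (a + b) / 2)"

lemma cell_resistance_sym: "cell_resistance a b p q = cell_resistance a b q p"
  by (simp add: cell_resistance_def insert_commute)

lemma cell_resistance_values:
  "cell_resistance a b sw se = (a + b) / 2" "cell_resistance a b se ne = (a + b) / 2"
  "cell_resistance a b ne nw = (a + b) / 2" "cell_resistance a b nw sw = (a + b) / 2"
  "cell_resistance a b sw ne = (a + a\<^sup>2 / b) / 2"
  "cell_resistance a b se nw = (b + b\<^sup>2 / a) / 2"
  by (simp_all add: cell_resistance_def doubleton_eq_iff)

text \<open>With \<open>A = 2/a\<close>, \<open>B = 2/b\<close>, \<open>C = 2/(a + b)\<close> the conductances are \<open>C\<close> along the sides and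
  \<open>A - C\<close>, \<open>B - C\<close> along the diagonals: the square in \<open>cell_form\<close> whose coefficient is \<open>C\<close> contributes
  with the opposite sign to pairs on the same diagonal.\<close>

lemma pair_energy_cell_resistance:
  assumes "a > 0" "b > 0"
  shows "pair_energy V0 (\<lambda>p q. 1 / cell_resistance a b p q) u = cell_form a b u"
proof -
  have sym: "1 / cell_resistance a b p q = 1 / cell_resistance a b q p" for p q
    by (rule arg_cong[OF cell_resistance_sym])
  have ab: "a + b > 0" using assms by simp
  have c: "1 / ((x + x\<^sup>2 / y) / 2) = 2 / x - 2 / (x + y)" if "x > 0" "y > 0" "x + y > 0" for x y :: real
  proof -
    have "x + x\<^sup>2 / y = x * (x + y) / y" using that by (simp add: field_simps power2_eq_square)
    then show ?thesis using that by (simp add: divide_simps)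
  qed
  define A B C where "A = 2 / a" and "B = 2 / b" and "C = 2 / (a + b)"
  have c': "1 / ((a + a\<^sup>2 / b) / 2) = A - C" "1 / ((b + b\<^sup>2 / a) / 2) = B - C"
    "1 / ((a + b) / 2) = C"
    using c[OF assms ab] c[OF assms(2,1)] ab by (simp_all add: A_def B_def C_def add.commute)
  have "pair_energy V0 (\<lambda>p q. 1 / cell_resistance a b p q) u =
      C * (u sw - u se)\<^sup>2 + C * (u se - u ne)\<^sup>2 + C * (u ne - u nw)\<^sup>2 + C * (u nw - u sw)\<^sup>2
      + (A - C) * (u sw - u ne)\<^sup>2 + (B - C) * (u se - u nw)\<^sup>2"
    unfolding pair_energy_V0[of "\<lambda>p q. 1 / cell_resistance a b p q", OF sym] cell_resistance_values c' ..
  also have "\<dots> = A * (u sw - u ne)\<^sup>2 + B * (u se - u nw)\<^sup>2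
      + C * (u sw + u ne - u se - u nw)\<^sup>2"
    by (simp add: power2_eq_square algebra_simps)
  also have "\<dots> = cell_form a b u"
    by (simp add: cell_form_def A_def B_def C_def)
  finally show ?thesis .
qed

text \<open>Indicator functions of one and of two corners give enough linear equations to recover the six
  conductances.\<close>

lemma conductances_unique:
  fixes c12 c23 c34 c41 c13 c24 d12 d23 d34 d41 d13 d24 :: real
  assumes eq: "\<And>x y z w.
      c12 * (x - y)\<^sup>2 + c23 * (y - z)\<^sup>2 + c34 * (z - w)\<^sup>2
      + c41 * (w - x)\<^sup>2 + c13 * (x - z)\<^sup>2 + c24 * (y - w)\<^sup>2
    = d12 * (x - y)\<^sup>2 + d23 * (y - z)\<^sup>2 + d34 * (z - w)\<^sup>2
      + d41 * (w - x)\<^sup>2 + d13 * (x - z)\<^sup>2 + d24 * (y - w)\<^sup>2"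
  shows "c12 = d12 \<and> c23 = d23 \<and> c34 = d34 \<and> c41 = d41 \<and> c13 = d13 \<and> c24 = d24"
proof -
  have "c12 + c41 + c13 = d12 + d41 + d13" using eq[of 1 0 0 0] by simp
  moreover have "c12 + c23 + c24 = d12 + d23 + d24" using eq[of 0 1 0 0] by simp
  moreover have "c23 + c34 + c13 = d23 + d34 + d13" using eq[of 0 0 1 0] by simp
  moreover have "c34 + c41 + c24 = d34 + d41 + d24" using eq[of 0 0 0 1] by simp
  moreover have "c23 + c41 + c13 + c24 = d23 + d41 + d13 + d24" using eq[of 1 1 0 0] by simp
  moreover have "c12 + c23 + c34 + c41 = d12 + d23 + d34 + d41" using eq[of 1 0 1 0] by simp
  ultimately show ?thesis by linarith
qed

lemma cell_form_determines_resistance: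
  assumes "a > 0" "b > 0"
    and sym: "\<forall>p\<in>V0. \<forall>q\<in>V0. R p q = R q p"
    and form: "\<forall>u. pair_energy V0 (\<lambda>p q. 1 / R p q) u = cell_form a b u"
    and "p \<in> V0" "q \<in> V0" "p \<noteq> q"
  shows "R p q = cell_resistance a b p q"
proof -
  let ?R = "cell_resistance a b"
  have sym': "\<forall>p\<in>V0. \<forall>q\<in>V0. ?R p q = ?R q p"
    by (intro ballI cell_resistance_sym)
  have same: "pair_energy V0 (\<lambda>p q. 1 / R p q) u = pair_energy V0 (\<lambda>p q. 1 / ?R p q) u" for u
    unfolding pair_energy_cell_resistance[OF assms(1,2)] by (rule form[rule_format])
  have expand: "pair_energy V0 (\<lambda>p q. 1 / r p q)
        (\<lambda>t. if t = sw then x else if t = se then y else if t = ne then z else w)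
      = 1 / r sw se * (x - y)\<^sup>2 + 1 / r se ne * (y - z)\<^sup>2 + 1 / r ne nw * (z - w)\<^sup>2
      + 1 / r nw sw * (w - x)\<^sup>2 + 1 / r sw ne * (x - z)\<^sup>2 + 1 / r se nw * (y - w)\<^sup>2"
    if r: "\<forall>p\<in>V0. \<forall>q\<in>V0. r p q = r q p" for r :: "point \<Rightarrow> point \<Rightarrow> real" and x y z w :: real
  proof -
    have "1 / r p q = 1 / r q p" if "p \<in> V0" "q \<in> V0" for p q
      by (rule arg_cong[OF r[rule_format, OF that]])
    from pair_energy_V0[of "\<lambda>p q. 1 / r p q", OF this] show ?thesis
      by (simp only: corners_distinct simp_thms if_True if_False)
  qed
  note eq = trans[OF trans[OF expand[OF sym, symmetric] same] expand[OF sym']]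
  have "1 / R sw se = 1 / ?R sw se \<and> 1 / R se ne = 1 / ?R se ne \<and> 1 / R ne nw = 1 / ?R ne nw
    \<and> 1 / R nw sw = 1 / ?R nw sw \<and> 1 / R sw ne = 1 / ?R sw ne \<and> 1 / R se nw = 1 / ?R se nw"
    by (rule conductances_unique) (rule eq)
  then have direct: "R sw se = ?R sw se" "R se ne = ?R se ne" "R ne nw = ?R ne nw"
    "R nw sw = ?R nw sw" "R sw ne = ?R sw ne" "R se nw = ?R se nw"
    by (simp_all only: divide_inverse mult_1 inverse_eq_iff_eq)
  have flip: "R q p = ?R q p" if "R p q = ?R p q" "p \<in> V0" "q \<in> V0" for p q
    by (rule trans[OF trans[OF sym[rule_format, OF that(3,2)] that(1)] cell_resistance_sym])
  have mem: "sw \<in> V0" "se \<in> V0" "ne \<in> V0" "nw \<in> V0" by (simp_all add: V0_eq)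
  note flipped = flip[OF direct(1) mem(1,2)] flip[OF direct(2) mem(2,3)] flip[OF direct(3) mem(3,4)]
    flip[OF direct(4) mem(4,1)] flip[OF direct(5) mem(1,3)] flip[OF direct(6) mem(2,4)]
  have "\<forall>p\<in>V0. \<forall>q\<in>V0. p \<noteq> q \<longrightarrow> R p q = ?R p q"
    unfolding V0_eq by (simp add: direct flipped)
  from this[rule_format, OF assms(5-7)] show ?thesis .
qed

section \<open>Asymptotics\<close>

lemma average_comparable:
  assumes "\<And>n. 0 \<le> d n" "\<And>n. d n \<le> g n"
  shows "(\<lambda>n. (g n + d n) / 2) \<asymp> g"
  unfolding comparable_def
proof (intro exI[of _ 2] conjI allI)
  fix n
  show "inverse 2 * g n \<le> (g n + d n) / 2" "(g n + d n) / 2 \<le> 2 * g n"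
    using assms[of n] by simp_all
qed simp

context
  fixes b :: "nat \<Rightarrow> real"
  assumes b_0: "b 0 = 1" and b_Suc: "\<And>n. b (Suc n) = next_b (9 ^ n) (b n)"
begin

lemma ratio_tendsto_0: "(\<lambda>n. b n / 9 ^ n) \<longlonglongrightarrow> 0"
proof -
  define t where "t n = b n / 9 ^ n" for n
  note b = b_bounds[OF b_0 b_Suc]
  have t_pos: "t n > 0" for n using b by (simp add: t_def)
  have t_Suc: "t (Suc n) = t n - (t n)\<^sup>2 / (9 * (1 + t n))" for n
  proof -
    have "b n = t n * 9 ^ n" by (simp add: t_def)
    moreover have "1 + t n > 0" using t_pos[of n] by simp
    moreover have "9 ^ n + t n * 9 ^ n = 9 ^ n * (1 + t n)" by (simp add: algebra_simps)
    ultimately show ?thesis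
      by (simp add: t_def[of "Suc n"] b_Suc next_b_def power2_eq_square divide_simps)
         (simp add: algebra_simps)
  qed
  have "t (Suc n) \<le> t n" for n using t_pos[of n] by (simp add: t_Suc)
  then obtain L where L: "t \<longlonglongrightarrow> L"
    using decseq_convergent[of t 0] t_pos by (metis decseq_SucI less_imp_le)
  have "L \<ge> 0" using L t_pos by (meson LIMSEQ_le_const less_imp_le)
  then have "(\<lambda>n. t (Suc n)) \<longlonglongrightarrow> L - L\<^sup>2 / (9 * (1 + L))"
    unfolding t_Suc by (intro tendsto_intros L) simp
  with LIMSEQ_Suc[OF L] have "L = L - L\<^sup>2 / (9 * (1 + L))"
    by (rule LIMSEQ_unique)
  then have "L = 0 \<or> 9 + 9 * L = 0" by simp
  then have "L = 0" using \<open>L \<ge> 0\<close> by linarith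
  then show ?thesis using L by (simp add: t_def[abs_def])
qed

text \<open>Since \<open>b n / 9 ^ n\<close> tends to 0, the growth factor of \<open>b\<close> is eventually at least \<open>9 - \<epsilon>/2\<close>, so
  the quotient grows at least like a geometric sequence with ratio \<open>(9 - \<epsilon>/2) / (9 - \<epsilon>)\<close>.\<close>

lemma b_dominates_power:
  assumes "0 < \<epsilon>" "\<epsilon> < 9"
  shows "filterlim (\<lambda>n. b n / (9 - \<epsilon>) ^ n) at_top sequentially"
proof -
  note b = b_bounds[OF b_0 b_Suc]
  let ?r = "9 - \<epsilon>" and ?q = "(9 - \<epsilon> / 2) / (9 - \<epsilon>)"
  have "\<forall>\<^sub>F n in sequentially. b n / 9 ^ n < \<epsilon> / 2"
    using ratio_tendsto_0 assms by (intro order_tendstoD(2)[of _ 0]) auto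
  then obtain N where N: "\<And>n. n \<ge> N \<Longrightarrow> b n / 9 ^ n < \<epsilon> / 2"
    by (auto simp: eventually_sequentially)
  have step: "b (Suc n) \<ge> (9 - \<epsilon> / 2) * b n" if "n \<ge> N" for n
  proof -
    have "b n / (9 ^ n + b n) \<le> b n / 9 ^ n"
      using b[of n] by (intro divide_left_mono) auto
    also have "\<dots> \<le> \<epsilon> / 2" using N[OF that] by simp
    finally have "b n * (b n / (9 ^ n + b n)) \<le> b n * (\<epsilon> / 2)"
      using b(1)[of n] by (intro mult_left_mono) auto
    then show ?thesis by (simp add: b_Suc next_b_def power2_eq_square algebra_simps)
  qed
  have ge: "b N / ?r ^ N * ?q ^ k \<le> b (k + N) / ?r ^ (k + N)" for k
  proof (induction k)
    case (Suc k)
    have "b N / ?r ^ N * ?q ^ Suc k = ?q * (b N / ?r ^ N * ?q ^ k)" by (simp add: mult_ac)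
    also have "\<dots> \<le> ?q * (b (k + N) / ?r ^ (k + N))"
      using Suc assms by (intro mult_left_mono) auto
    also have "\<dots> = ((9 - \<epsilon> / 2) * b (k + N)) / ?r ^ (Suc k + N)" by simp
    also have "\<dots> \<le> b (Suc k + N) / ?r ^ (Suc k + N)"
      using step[of "k + N"] assms by (intro divide_right_mono) auto
    finally show ?case .
  qed simp
  have "1 < ?q" using assms by (simp add: field_simps)
  then have "1 < norm ?q" using abs_ge_self[of ?q] unfolding real_norm_def by linarith
  then have "filterlim (\<lambda>k. ?q ^ k) at_infinity sequentially"
    by (rule filterlim_realpow_sequentially_gt1)
  then have "filterlim (\<lambda>k. ?q ^ k) at_top sequentially"
    using \<open>1 < ?q\<close> by (intro filterlim_at_infinity_imp_filterlim_at_top) auto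
  moreover have "b N / ?r ^ N > 0" using b(1) assms by simp
  ultimately have "filterlim (\<lambda>k. b N / ?r ^ N * ?q ^ k) at_top sequentially"
    by (intro filterlim_tendsto_pos_mult_at_top[OF tendsto_const])
  then have "filterlim (\<lambda>k. b (k + N) / ?r ^ (k + N)) at_top sequentially"
    by (rule filterlim_at_top_mono) (intro always_eventually allI ge)
  then show ?thesis
    unfolding filterlim_iff
    using eventually_sequentially_seg[of "\<lambda>n. P (b n / ?r ^ n)" N for P] by simp
qed

end

theorem proposition5p2:
  fixes I :: "index set" and K :: "point set" and a b :: "nat \<Rightarrow> real"
  assumes "eyebolted_vicsek_cross I K"
    and "\<And>n. a n = 9 ^ n"
    and "b 0 = 1"
    and "\<And>n. n \<ge> 1 \<Longrightarrow> b n = 9 * b (n - 1) - (b (n - 1))\<^sup>2 / (9 ^ (n - 1) + b (n - 1))"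
  shows "(\<forall>i\<in>{1..4}. (\<forall>n. trace_resistance I n (corner i) (corner (i + 1)) = (a n + b n) / 2) \<and>
            (\<lambda>n. trace_resistance I n (corner i) (corner (i + 1))) \<asymp> a)
    \<and> (\<forall>n. trace_resistance I n (corner 1) (corner 3) = (a n + (a n)\<^sup>2 / b n) / 2) \<and>
        (\<lambda>n. trace_resistance I n (corner 1) (corner 3)) \<asymp> (\<lambda>n. (a n)\<^sup>2 / b n)
    \<and> (\<forall>n. trace_resistance I n (corner 2) (corner 4) = (b n + (b n)\<^sup>2 / a n) / 2) \<and>
        (\<lambda>n. trace_resistance I n (corner 2) (corner 4)) \<asymp> b
    \<and> (\<lambda>n. b n / 9 ^ n) \<longlonglongrightarrow> 0
    \<and> (\<forall>\<epsilon>. 0 < \<epsilon> \<and> \<epsilon> < 9 \<longrightarrow> filterlim (\<lambda>n. b n / (9 - \<epsilon>) ^ n) at_top sequentially)"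
proof -
  have I: "eyebolted I" using assms(1) by (simp add: eyebolted_vicsek_cross_def)
  have b_Suc: "b (Suc n) = next_b (9 ^ n) (b n)" for n
    using assms(4)[of "Suc n"] by (simp add: next_b_def)
  have b: "0 < b n" "b n \<le> a n" for n
    using b_bounds[OF assms(3) b_Suc] by (simp_all add: assms(2))
  have a: "a n > 0" for n by (simp add: assms(2))
  have R: "trace_resistance I n p q = cell_resistance (a n) (b n) p q"
    if "p \<in> V0" "q \<in> V0" "p \<noteq> q" for n p q
  proof -
    note trace_iff = is_trace_iff[OF assms(3) b_Suc I, of n, folded assms(2)]
    have "is_trace I n (cell_resistance (a n) (b n))"
      unfolding trace_iff
      by (simp add: pair_energy_cell_resistance a b) (simp add: cell_resistance_def insert_commute)
    then have "is_trace I n (trace_resistance I n)"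
      unfolding trace_resistance_def by (rule someI[of "is_trace I n"])
    then show ?thesis
      unfolding trace_iff using cell_form_determines_resistance[OF a b(1)] that by blast
  qed
  have side: "trace_resistance I n (corner i) (corner (i + 1)) = (a n + b n) / 2"
    if "i \<in> {1..4}" for i n
  proof -
    have "i = 1 \<or> i = 2 \<or> i = 3 \<or> i = 4" using that by auto
    then have "(corner i, corner (i + 1)) \<in> {(sw, se), (se, ne), (ne, nw), (nw, sw)}"
      using corner_eqs by (auto simp: numeral_eq_Suc)
    then show ?thesis
      by (elim insertE emptyE) (simp_all add: R V0_eq cell_resistance_values)
  qed
  have diag: "trace_resistance I n (corner 1) (corner 3) = (a n + (a n)\<^sup>2 / b n) / 2"
    "trace_resistance I n (corner 2) (corner 4) = (b n + (b n)\<^sup>2 / a n) / 2" for n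
    unfolding corner_eqs by (simp_all add: R V0_eq cell_resistance_values)
  have ratio: "a n \<le> (a n)\<^sup>2 / b n" "(b n)\<^sup>2 / a n \<le> b n" "0 \<le> (b n)\<^sup>2 / a n" for n
    using a[of n] b[of n] by (simp_all add: power2_eq_square divide_simps)
  have "(\<lambda>n. trace_resistance I n (corner i) (corner (i + 1))) \<asymp> a" if "i \<in> {1..4}" for i
    unfolding side[OF that] using b by (intro average_comparable) (simp_all add: less_imp_le)
  moreover have "(\<lambda>n. trace_resistance I n (corner 1) (corner 3)) \<asymp> (\<lambda>n. (a n)\<^sup>2 / b n)"
    unfolding diag add.commute[of "a _"]
    using a ratio by (intro average_comparable) (simp_all add: less_imp_le)
  moreover have "(\<lambda>n. trace_resistance I n (corner 2) (corner 4)) \<asymp> b"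
    unfolding diag using ratio by (intro average_comparable)
  ultimately show ?thesis
    using side diag ratio_tendsto_0[OF assms(3) b_Suc] b_dominates_power[OF assms(3) b_Suc]
    by blast
qed

end
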